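(* Let $S^1=[0,1)$ with addition mod 1 and $T(x)=2x\pmod 1$. Let $J_1,J_2:S^1\to\mathbb{R}$ be positive Hölder continuous functions with $\sum_{x:\,T(x)=y}J_i(x)=1$ for all $y$, and let $\mu_i$ be the Gibbs probability for $\log J_i$ ($\mathcal{L}_{\log J_i}^*\mu_i=\mu_i$), $i=1,2$. If $\nu=\mu_1*\mu_2$, then $h(\nu)\ge h(\mu_2)$. Moreover, $h(\nu)>h(\mu_2)$ unless $\mu_1$ or $\mu_2$ is the Lebesgue probability.
   Context: The Ruelle operator is $\mathcal{L}_{\log J}(\varphi)(y)=\sum_{x:\,T(x)=y}J(x)\varphi(x)$ and $\mathcal{L}_{\log J}^*$ its dual on probabilities. Convolution: $\int\phi\,d(\eta*\mu)=\int\!\!\int\phi(x+y)\,d\mu(y)\,d\eta(x)$ (sums mod 1). $h$ denotes Kolmogorov–Sinai entropy with respect to $T$. *)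

theory Defs
  imports "HOL-Probability.Probability"
begin

definition S1 :: "real set" where "S1 = {0..<1}"

definition S1_borel :: "real measure" where
  "S1_borel = restrict_space borel S1"

definition doubling :: "real \<Rightarrow> real" where
  "doubling x = frac (2 * x)"

definition lebesgue_S1 :: "real measure" where
  "lebesgue_S1 = restrict_space lborel S1"

definition prob_S1 :: "real measure \<Rightarrow> bool" where
  "prob_S1 \<mu> \<longleftrightarrow> prob_space \<mu> \<and> sets \<mu> = sets S1_borel"

definition circ_dist :: "real \<Rightarrow> real \<Rightarrow> real" where
  "circ_dist x y = min \<bar>x - y\<bar> (1 - \<bar>x - y\<bar>)"

definition holder_S1 :: "(real \<Rightarrow> real) \<Rightarrow> bool" where
  "holder_S1 J \<longleftrightarrow> (\<exists>C \<alpha>. 0 < \<alpha> \<and> \<alpha> \<le> 1 \<and>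
     (\<forall>x\<in>S1. \<forall>y\<in>S1. \<bar>J x - J y\<bar> \<le> C * circ_dist x y powr \<alpha>))"

definition ruelle_op :: "(real \<Rightarrow> real) \<Rightarrow> (real \<Rightarrow> real) \<Rightarrow> real \<Rightarrow> real" where
  "ruelle_op J \<phi> y = (\<Sum>x\<in>{x\<in>S1. doubling x = y}. J x * \<phi> x)"

definition ruelle_dual :: "(real \<Rightarrow> real) \<Rightarrow> real measure \<Rightarrow> real measure" where
  "ruelle_dual J \<mu> = measure_of S1 (sets S1_borel)
     (\<lambda>A. \<integral>\<^sup>+ y. ennreal (ruelle_op J (indicator A) y) \<partial>\<mu>)"

definition gibbs_S1 :: "(real \<Rightarrow> real) \<Rightarrow> real measure \<Rightarrow> bool" where
  "gibbs_S1 J \<mu> \<longleftrightarrow> prob_S1 \<mu> \<and> ruelle_dual J \<mu> = \<mu>"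

definition conv_S1 :: "real measure \<Rightarrow> real measure \<Rightarrow> real measure" where
  "conv_S1 \<eta> \<mu> = distr (\<eta> \<Otimes>\<^sub>M \<mu>) S1_borel (\<lambda>(x, y). frac (x + y))"

definition meas_partition :: "real measure \<Rightarrow> real set set \<Rightarrow> bool" where
  "meas_partition \<mu> P \<longleftrightarrow> finite P \<and> P \<subseteq> sets \<mu> \<and> \<Union>P = space \<mu> \<and>
     (\<forall>A\<in>P. \<forall>B\<in>P. A \<noteq> B \<longrightarrow> A \<inter> B = {})"

definition part_join :: "real measure \<Rightarrow> nat \<Rightarrow> real set set \<Rightarrow> real set set" where
  "part_join \<mu> n P = {space \<mu> \<inter> (\<Inter>i<n. (doubling ^^ i) -` (f i)) | f. \<forall>i<n. f i \<in> P}"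

definition ent_term :: "real \<Rightarrow> real" where
  "ent_term p = (if p = 0 then 0 else - p * ln p)"

definition part_entropy :: "real measure \<Rightarrow> real set set \<Rightarrow> real" where
  "part_entropy \<mu> Q = (\<Sum>A\<in>Q. ent_term (measure \<mu> A))"

definition ks_entropy_partition :: "real measure \<Rightarrow> real set set \<Rightarrow> real" where
  "ks_entropy_partition \<mu> P = lim (\<lambda>n. part_entropy \<mu> (part_join \<mu> (Suc n) P) / real (Suc n))"

definition ks_entropy :: "real measure \<Rightarrow> real" where
  "ks_entropy \<mu> = (SUP P \<in> {P. meas_partition \<mu> P}. ks_entropy_partition \<mu> P)"

end

theory Submission
  imports Defs
begin

text \<open>Rokhlin's formula expresses entropy through the Jacobian: if J is the Jacobian of an
  invariant measure M, i.e. J (x) is the conditional probability of x given its image under the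
  doubling map, then h (M) is the integral of - ln J. For M = \<mu>1 * \<mu>2 and fixed x, the
  function y \<mapsto> J (x + y) is again normalised on the fibres, so Gibbs' inequality against
  the Jacobian J2 of \<mu>2 gives h (M) \<ge> h (\<mu>2), with equality only if J (x + y) = J2 (y)
  almost surely. J is merely measurable, but since \<mu>1 and \<mu>2 are quasi-invariant under
  dyadic rotations, x and y may be moved by opposite dyadic amounts; hence J2 is constant along a
  dense set, so J2 = 1/2 and \<mu>2 is Lebesgue measure.\<close>

section \<open>Entropy of finite-valued functions\<close>

text \<open>Each measure enters with one inequality of Rokhlin's formula, along the chain h(mu2) <=
  int - ln J2 <= int - ln J <= h(nu), where nu is the convolution. The first inequality rests on J2
  being uniformly continuous and bounded away from 0: ratios of cylinder measures are then uniformly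
  close to J2. The last one must hold for a Jacobian obtained from Radon-Nikodym alone; there Gibbs'
  inequality is used a second time, with the ratios of cylinder measures as competitors of J. Both
  arguments concern the partition by the first binary digit, whereas entropy is a supremum over all
  finite partitions, so the generator theorem is needed to connect the two; its core is that a fixed
  partition has small conditional entropy given sufficiently many digits. Radon-Nikodym yields a
  fibre sum of 1 only almost everywhere; J is corrected on a null set so that translation by any x
  preserves the normalisation.\<close>

lemma ent_term_eq: "ent_term p = - (p * ln p)"
  by (simp add: ent_term_def)

lemma ent_term_nonneg: "0 \<le> p \<Longrightarrow> p \<le> 1 \<Longrightarrow> 0 \<le> ent_term p"
  by (cases "p = 0") (auto simp: ent_term_eq intro!: mult_nonneg_nonpos)

text \<open>This is nonnegativity of conditional mutual information for unnormalised weights. The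
  inequality ln t <= t - 1 is applied to t = Q R / (P S), the ratio between the weights that make a
  and b independent given c and the actual ones; both sides of the resulting bound have total mass
  equal to the sum of S.\<close>

lemma strong_subadditivity_sum:
  fixes P :: "'a \<Rightarrow> 'b \<Rightarrow> 'c \<Rightarrow> real"
  assumes fin: "finite A" "finite B" "finite C"
    and P: "\<And>a b c. 0 \<le> P a b c"
  defines "Q \<equiv> \<lambda>a c. \<Sum>b\<in>B. P a b c"
    and "R \<equiv> \<lambda>b c. \<Sum>a\<in>A. P a b c"
    and "S \<equiv> \<lambda>c. \<Sum>a\<in>A. \<Sum>b\<in>B. P a b c"
  shows "(\<Sum>a\<in>A. \<Sum>b\<in>B. \<Sum>c\<in>C. ent_term (P a b c)) + (\<Sum>c\<in>C. ent_term (S c))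
    \<le> (\<Sum>a\<in>A. \<Sum>c\<in>C. ent_term (Q a c)) + (\<Sum>b\<in>B. \<Sum>c\<in>C. ent_term (R b c))"
proof -
  have Q0: "0 \<le> Q a c" and R0: "0 \<le> R b c" and S0: "0 \<le> S c" for a b c
    unfolding Q_def R_def S_def by (auto intro!: sum_nonneg P)
  have step: "ent_term (P a b c) + P a b c * ln (Q a c) + P a b c * ln (R b c) - P a b c * ln (S c)
      \<le> Q a c * R b c / S c - P a b c" (is "?l \<le> ?r") if "a \<in> A" "b \<in> B" for a b c
  proof (cases "P a b c = 0")
    case True
    then show ?thesis using Q0[of a c] R0[of b c] S0[of c] by (simp add: ent_term_eq)
  next
    case False
    then have p: "P a b c > 0" using P[of a b c] by linarith
    have "P a b c \<le> Q a c" "P a b c \<le> R b c" unfolding Q_def R_def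
      using that fin P by (auto intro!: member_le_sum)
    moreover have "Q a c \<le> S c" unfolding S_def Q_def
      using that fin P by (auto intro!: member_le_sum[where f="\<lambda>a. \<Sum>b\<in>B. P a b c"] sum_nonneg)
    ultimately have pos: "Q a c > 0" "R b c > 0" "S c > 0" using p by auto
    let ?t = "Q a c * R b c / (P a b c * S c)"
    have t: "?t > 0" using pos p by simp
    have "?l = P a b c * ln ?t"
      using pos p by (simp add: ent_term_eq ln_mult ln_div algebra_simps)
    also have "\<dots> \<le> P a b c * (?t - 1)"
      using ln_le_minus_one[OF t] p by (simp add: mult_left_mono)
    also have "\<dots> = ?r" using p pos by (simp add: field_simps)
    finally show ?thesis .
  qed
  have Ssum: "S c = (\<Sum>a\<in>A. Q a c)" "S c = (\<Sum>b\<in>B. R b c)" for c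
    unfolding S_def Q_def R_def by (auto intro: sum.swap)
  have swap: "(\<Sum>a\<in>A. \<Sum>b\<in>B. \<Sum>c\<in>C. f a b c) = (\<Sum>c\<in>C. \<Sum>a\<in>A. \<Sum>b\<in>B. f a b c)"
    for f :: "'a \<Rightarrow> 'b \<Rightarrow> 'c \<Rightarrow> real"
  proof -
    have "(\<Sum>a\<in>A. \<Sum>b\<in>B. \<Sum>c\<in>C. f a b c) = (\<Sum>a\<in>A. \<Sum>c\<in>C. \<Sum>b\<in>B. f a b c)"
      by (intro sum.cong refl sum.swap)
    also have "\<dots> = (\<Sum>c\<in>C. \<Sum>a\<in>A. \<Sum>b\<in>B. f a b c)"
      by (rule sum.swap)
    finally show ?thesis .
  qed
  have 1: "(\<Sum>a\<in>A. \<Sum>b\<in>B. \<Sum>c\<in>C. P a b c * ln (Q a c)) = - (\<Sum>a\<in>A. \<Sum>c\<in>C. ent_term (Q a c))"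
    unfolding sum_negf[symmetric] Q_def
    by (intro sum.cong refl, subst sum.swap) (simp add: ent_term_eq sum_distrib_right sum_negf)
  have 2: "(\<Sum>a\<in>A. \<Sum>b\<in>B. \<Sum>c\<in>C. P a b c * ln (R b c)) = - (\<Sum>b\<in>B. \<Sum>c\<in>C. ent_term (R b c))"
    unfolding sum_negf[symmetric] R_def
    by (subst sum.swap, intro sum.cong refl, subst sum.swap) (simp add: ent_term_eq sum_distrib_right sum_negf)
  have 3: "(\<Sum>a\<in>A. \<Sum>b\<in>B. \<Sum>c\<in>C. P a b c * ln (S c)) = - (\<Sum>c\<in>C. ent_term (S c))"
    by (subst swap) (simp add: ent_term_eq S_def sum_distrib_right sum_negf)
  have 4: "(\<Sum>a\<in>A. \<Sum>b\<in>B. \<Sum>c\<in>C. P a b c) = (\<Sum>c\<in>C. S c)"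
    by (subst swap) (simp add: S_def)
  have "(\<Sum>a\<in>A. \<Sum>b\<in>B. Q a c * R b c / S c) = S c" for c
  proof -
    have "(\<Sum>a\<in>A. \<Sum>b\<in>B. Q a c * R b c / S c) = (\<Sum>a\<in>A. Q a c) * (\<Sum>b\<in>B. R b c) / S c"
      by (simp add: sum_product sum_divide_distrib)
    \<comment> \<open>S c * S c / S c equals S c even for S c = 0, because division by 0 gives
      0.\<close>
    also have "\<dots> = S c" unfolding Ssum[symmetric] by simp
    finally show ?thesis .
  qed
  then have 5: "(\<Sum>a\<in>A. \<Sum>b\<in>B. \<Sum>c\<in>C. Q a c * R b c / S c) = (\<Sum>c\<in>C. S c)"
    by (subst swap) simp
  have "(\<Sum>a\<in>A. \<Sum>b\<in>B. \<Sum>c\<in>C. ent_term (P a b c) + P a b c * ln (Q a c) + P a b c * ln (R b c) - P a b c * ln (S c))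
    \<le> (\<Sum>a\<in>A. \<Sum>b\<in>B. \<Sum>c\<in>C. Q a c * R b c / S c - P a b c)"
    by (intro sum_mono step)
  then show ?thesis
    using 1 2 3 4 5 unfolding S_def[symmetric] Q_def[symmetric] R_def[symmetric]
    by (simp add: sum.distrib sum_subtractf)
qed

text \<open>Partitions are handled through labelling functions; their entropy depends on the
  fibres only, so relabelling needs no bookkeeping.\<close>

definition cells :: "real measure \<Rightarrow> (real \<Rightarrow> 'k) \<Rightarrow> real set set" where
  "cells M f = (\<lambda>x. {y\<in>space M. f y = f x}) ` space M"

definition fent :: "real measure \<Rightarrow> (real \<Rightarrow> 'k) \<Rightarrow> real" where
  "fent M f = part_entropy M (cells M f)"

lemma fent_cong:
  assumes "\<And>x y. x \<in> space M \<Longrightarrow> y \<in> space M \<Longrightarrow> f x = f y \<longleftrightarrow> g x = g y"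
  shows "fent M f = fent M g"
proof -
  have "cells M f = cells M g" unfolding cells_def using assms by (intro image_cong) auto
  then show ?thesis by (simp add: fent_def)
qed

lemma fent_eq_sum:
  assumes "finite K" "f ` space M \<subseteq> K"
  shows "fent M f = (\<Sum>k\<in>K. ent_term (measure M {y\<in>space M. f y = k}))"
proof -
  let ?g = "\<lambda>k. {y\<in>space M. f y = k}"
  have "cells M f = ?g ` (f ` space M)" by (auto simp: cells_def)
  moreover have "inj_on ?g (f ` space M)" by (auto simp: inj_on_def)
  ultimately have "fent M f = (\<Sum>k\<in>f ` space M. ent_term (measure M (?g k)))"
    by (simp add: fent_def part_entropy_def sum.reindex)
  also have "\<dots> = (\<Sum>k\<in>K. ent_term (measure M (?g k)))"
  proof (rule sum.mono_neutral_left[OF assms])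
    show "\<forall>k\<in>K - f ` space M. ent_term (measure M (?g k)) = 0"
    proof
      fix k assume "k \<in> K - f ` space M"
      then have "?g k = {}" by auto
      then show "ent_term (measure M (?g k)) = 0" by (simp only: measure_empty) (simp add: ent_term_eq)
    qed
  qed
  finally show ?thesis .
qed

section \<open>Entropy of simple functions on a probability space\<close>

locale real_prob_space = prob_space M for M :: "real measure"
begin

lemma fibre_sets [measurable]: "simple_function M f \<Longrightarrow> {y\<in>space M. f y = k} \<in> events"
  using simple_functionD(2)[of M f "{k}"] by (simp add: vimage_def Int_def conj_commute)

lemma prob_eq_sum_fibres:
  assumes f: "simple_function M f" and K: "finite K" "f ` space M \<subseteq> K" and A: "A \<in> events"
  shows "prob A = (\<Sum>k\<in>K. prob {y\<in>A. f y = k})"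
proof -
  have "prob A = prob (\<Union>k\<in>K. {y\<in>A. f y = k})"
    using K(2) sets.sets_into_space[OF A] by (intro arg_cong[where f=prob]) auto
  also have "\<dots> = (\<Sum>k\<in>K. prob {y\<in>A. f y = k})"
  proof (rule finite_measure_finite_Union[OF K(1)])
    have "{y\<in>A. f y = k} = A \<inter> {y\<in>space M. f y = k}" for k
      using sets.sets_into_space[OF A] by auto
    then show "(\<lambda>k. {y\<in>A. f y = k}) ` K \<subseteq> events" using fibre_sets[OF f] A by auto
  qed (auto simp: disjoint_family_on_def)
  finally show ?thesis .
qed

lemma fent_nonneg: "simple_function M f \<Longrightarrow> 0 \<le> fent M f"
  by (subst fent_eq_sum[OF simple_functionD(1) order.refl])
     (auto intro!: sum_nonneg ent_term_nonneg)

lemma fent_Pair: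
  assumes f: "simple_function M f" and g: "simple_function M g"
  shows "fent M (\<lambda>x. (f x, g x)) =
    (\<Sum>a\<in>f`space M. \<Sum>b\<in>g`space M. ent_term (prob {y\<in>space M. f y = a \<and> g y = b}))"
  using simple_functionD(1)[OF f] simple_functionD(1)[OF g]
  by (subst fent_eq_sum[of "f`space M \<times> g`space M"])
     (auto simp: sum.cartesian_product case_prod_beta prod_eq_iff)

text \<open>The weights are the joint distribution of \<open>f\<close>, \<open>g\<close>,
  \<open>h\<close>; Q, R and S are its marginals. In terms of conditional entropy: H(f, g | h) <=
  H(f | h) + H(g | h).\<close>

lemma fent_strong_subadditive:
  assumes f: "simple_function M f" and g: "simple_function M g" and h: "simple_function M h"
  shows "fent M (\<lambda>x. (f x, g x, h x)) + fent M h \<le> fent M (\<lambda>x. (f x, h x)) + fent M (\<lambda>x. (g x, h x))"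
proof -
  let ?P = "\<lambda>a b c. prob {y\<in>space M. f y = a \<and> g y = b \<and> h y = c}"
  note fin = simple_functionD(1)[OF f] simple_functionD(1)[OF g] simple_functionD(1)[OF h]
  have [measurable]: "{y\<in>space M. f y = a \<and> h y = c} \<in> events" "{y\<in>space M. g y = b \<and> h y = c} \<in> events" for a b c
    using fibre_sets[OF simple_function_Pair[OF f h], of "(a, c)"]
      fibre_sets[OF simple_function_Pair[OF g h], of "(b, c)"] by auto
  have Q: "prob {y\<in>space M. f y = a \<and> h y = c} = (\<Sum>b\<in>g`space M. ?P a b c)" for a c
    by (subst prob_eq_sum_fibres[OF g fin(2) order.refl]) (auto intro!: sum.cong arg_cong[where f=prob])
  have R: "prob {y\<in>space M. g y = b \<and> h y = c} = (\<Sum>a\<in>f`space M. ?P a b c)" for b c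
    by (subst prob_eq_sum_fibres[OF f fin(1) order.refl]) (auto intro!: sum.cong arg_cong[where f=prob])
  have S: "prob {y\<in>space M. h y = c} = (\<Sum>a\<in>f`space M. \<Sum>b\<in>g`space M. ?P a b c)" for c
    unfolding Q[symmetric]
    by (subst prob_eq_sum_fibres[OF f fin(1) order.refl])
       (auto intro!: sum.cong arg_cong[where f=prob] fibre_sets h)
  have "fent M (\<lambda>x. (f x, g x, h x)) =
      (\<Sum>a\<in>f`space M. \<Sum>b\<in>g`space M. \<Sum>c\<in>h`space M. ent_term (?P a b c))"
    using fin by (subst fent_eq_sum[of "f`space M \<times> g`space M \<times> h`space M"])
      (auto simp: sum.cartesian_product case_prod_beta prod_eq_iff)
  then show ?thesis
    using strong_subadditivity_sum[of "f`space M" "g`space M" "h`space M" ?P] fin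
    by (simp add: fent_Pair f g h Q R S fent_eq_sum[OF fin(3) order.refl])
qed

text \<open>A fibre of \<open>f\<close> of measure p is cut into pieces of measure q <= p, and - ln
  q >= - ln p on each piece that has positive measure.\<close>

lemma fent_mono:
  assumes f: "simple_function M f" and g: "simple_function M g"
  shows "fent M f \<le> fent M (\<lambda>x. (f x, g x))"
proof -
  have "ent_term (prob {y\<in>space M. f y = a}) \<le>
      (\<Sum>b\<in>g`space M. ent_term (prob {y\<in>space M. f y = a \<and> g y = b}))" (is "ent_term ?p \<le> sum ?e _") for a
  proof -
    let ?q = "\<lambda>b. prob {y\<in>space M. f y = a \<and> g y = b}"
    have p: "?p = (\<Sum>b\<in>g`space M. ?q b)"
      by (subst prob_eq_sum_fibres[OF g simple_functionD(1)[OF g] order.refl])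
         (auto intro!: sum.cong arg_cong[where f=prob] fibre_sets f)
    have "ent_term ?p = (\<Sum>b\<in>g`space M. ?q b * - ln ?p)"
      by (simp add: ent_term_eq p sum_distrib_right sum_negf)
    also have "\<dots> \<le> sum ?e (g`space M)"
    proof (rule sum_mono)
      fix b
      have "?q b \<le> ?p" by (intro finite_measure_mono) (auto intro: fibre_sets f)
      then show "?q b * - ln ?p \<le> ?e b"
        using measure_nonneg[of M "{y\<in>space M. f y = a \<and> g y = b}"]
        by (cases "?q b = 0") (auto simp: ent_term_eq zero_less_measure_iff intro!: mult_left_mono ln_mono)
    qed
    finally show ?thesis .
  qed
  then show ?thesis
    unfolding fent_Pair[OF f g] fent_eq_sum[OF simple_functionD(1)[OF f] order.refl]
    by (rule sum_mono)
qed

lemma integral_simple_function_real: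
  fixes \<phi> :: "'k \<Rightarrow> real"
  assumes f: "simple_function M f"
  shows "(\<integral>x. \<phi> (f x) \<partial>M) = (\<Sum>k\<in>f`space M. \<phi> k * prob {y\<in>space M. f y = k})"
    and "integrable M (\<lambda>x. \<phi> (f x))"
proof -
  note fin = simple_functionD(1)[OF f]
  have eq: "\<phi> (f x) = (\<Sum>k\<in>f`space M. \<phi> k * indicator {y\<in>space M. f y = k} x)" if "x \<in> space M" for x
    using that fin by (auto simp: indicator_def sum.delta if_distrib cong: if_cong)
  have i: "integrable M (\<lambda>x. \<Sum>k\<in>f`space M. \<phi> k * indicator {y\<in>space M. f y = k} x)"
    by (auto intro!: Bochner_Integration.integrable_sum integrable_mult_right integrable_real_indicator fibre_sets f simp: less_top[symmetric])
  show "integrable M (\<lambda>x. \<phi> (f x))"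
    using i by (rule Bochner_Integration.integrable_cong[THEN iffD1, rotated 2]) (auto simp: eq[symmetric])
  have "(\<integral>x. \<phi> (f x) \<partial>M) = (\<integral>x. (\<Sum>k\<in>f`space M. \<phi> k * indicator {y\<in>space M. f y = k} x) \<partial>M)"
    by (intro Bochner_Integration.integral_cong refl eq)
  also have "\<dots> = (\<Sum>k\<in>f`space M. \<phi> k * prob {y\<in>space M. f y = k})"
    using fibre_sets[OF f] by (subst Bochner_Integration.integral_sum) (auto intro!: sum.cong integrable_mult_right integrable_real_indicator simp: less_top[symmetric])
  finally show "(\<integral>x. \<phi> (f x) \<partial>M) = (\<Sum>k\<in>f`space M. \<phi> k * prob {y\<in>space M. f y = k})" .
qed

text \<open>Entropy as mean information; this form can be compared with the integral of - ln of a
  Jacobian.\<close>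

lemma fent_eq_integral:
  assumes f: "simple_function M f"
  shows "fent M f = (\<integral>x. - ln (prob {y\<in>space M. f y = f x}) \<partial>M)"
  using integral_simple_function_real(1)[OF f, of "\<lambda>k. - ln (prob {y\<in>space M. f y = k})"]
  by (simp add: fent_eq_sum[OF simple_functionD(1)[OF f] order.refl] ent_term_eq mult.commute)

lemma AE_fibre_pos:
  assumes f: "simple_function M f"
  shows "AE x in M. 0 < prob {y\<in>space M. f y = f x}"
proof -
  have "AE x in M. \<forall>k\<in>f`space M. prob {y\<in>space M. f y = k} = 0 \<longrightarrow> x \<notin> {y\<in>space M. f y = k}"
    (is "AE x in M. \<forall>k\<in>_. ?Q k x")
  proof (rule AE_finite_allI[OF simple_functionD(1)[OF f]])
    fix k
    show "AE x in M. ?Q k x"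
    proof (cases "prob {y\<in>space M. f y = k} = 0")
      case True
      then have "{y\<in>space M. f y = k} \<in> null_sets M"
        by (auto simp: null_sets_def emeasure_eq_measure fibre_sets[OF f])
      from AE_not_in[OF this] show ?thesis by simp
    qed simp
  qed
  then show ?thesis using AE_space by eventually_elim (auto simp: zero_less_measure_iff)
qed

end

section \<open>Itineraries under the doubling map\<close>

lemma space_S1_borel [simp]: "space S1_borel = S1"
  by (simp add: S1_borel_def space_restrict_space)

lemma S1_borel_sets [measurable, simp]: "S1 \<in> sets borel"
  by (simp add: S1_def)

lemma frac_in_S1 [simp]: "frac x \<in> S1"
  by (simp add: S1_def frac_lt_1)

lemma frac_S1 [simp]: "x \<in> S1 \<Longrightarrow> frac x = x"
  by (simp add: S1_def frac_eq)

lemma doubling_in_S1 [simp]: "doubling x \<in> S1"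
  by (simp add: doubling_def)

lemma funpow_doubling_in_S1 [simp]: "x \<in> S1 \<Longrightarrow> (doubling ^^ n) x \<in> S1"
  by (induction n) auto

lemma borel_measurable_frac [measurable]: "(frac :: real \<Rightarrow> real) \<in> borel_measurable borel"
  unfolding frac_def[abs_def] by measurable

lemma measurable_frac_S1 [measurable]: "frac \<in> measurable borel S1_borel"
  unfolding S1_borel_def by (rule measurable_restrict_space2) auto

lemma measurable_S1_id [measurable]: "(\<lambda>x. x) \<in> borel_measurable S1_borel"
  unfolding S1_borel_def by (rule measurable_restrict_space1) simp

lemma measurable_doubling [measurable]: "doubling \<in> measurable S1_borel S1_borel"
  unfolding doubling_def[abs_def] by measurable

text \<open>The itinerary stands for the n-fold join: two points lie in the same atom of the join
  exactly when their itineraries agree.\<close>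

definition itin :: "(real \<Rightarrow> 'k) \<Rightarrow> nat \<Rightarrow> real \<Rightarrow> 'k list" where
  "itin l n x = map (\<lambda>i. l ((doubling ^^ i) x)) [0..<n]"

lemma itin_0 [simp]: "itin l 0 x = []"
  by (simp add: itin_def)

lemma itin_Suc: "itin l (Suc n) x = l x # itin l n (doubling x)"
  unfolding itin_def map_upt_Suc by (simp add: funpow_swap1)

lemma itin_snoc: "itin l (Suc n) x = itin l n x @ [l ((doubling ^^ n) x)]"
  by (simp add: itin_def)

lemma take_itin: "n \<le> m \<Longrightarrow> take n (itin l m x) = itin l n x"
  by (simp add: itin_def take_map)

lemma itin_eq_mono: "itin l m x = itin l m y \<Longrightarrow> n \<le> m \<Longrightarrow> itin l n x = itin l n y"
  by (metis take_itin)

text \<open>The increments of a concave sequence decrease, so n times the next increment is at most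
  the sum \<open>a n\<close> of the first n ones. This makes the averages decrease, and they are
  bounded below by 0.\<close>

lemma concave_average_convergent:
  fixes a :: "nat \<Rightarrow> real"
  assumes "a 0 = 0" "\<And>n. 0 \<le> a n" and conc: "\<And>n. a (Suc (Suc n)) + a n \<le> 2 * a (Suc n)"
  shows "convergent (\<lambda>n. a (Suc n) / real (Suc n))"
proof -
  have step: "real n * (a (Suc n) - a n) \<le> a n" for n
  proof (induction n)
    case (Suc n)
    have "real (Suc n) * (a (Suc (Suc n)) - a (Suc n)) \<le> real (Suc n) * (a (Suc n) - a n)"
      using conc[of n] by (intro mult_left_mono) auto
    also have "\<dots> \<le> a (Suc n)" using Suc by (simp add: algebra_simps)
    finally show ?case .
  qed (use assms in simp)
  have "decseq (\<lambda>n. a (Suc n) / real (Suc n))"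
  proof (rule decseq_SucI)
    fix n show "a (Suc (Suc n)) / real (Suc (Suc n)) \<le> a (Suc n) / real (Suc n)"
      using step[of "Suc n"] by (simp add: field_simps)
  qed
  moreover have "\<forall>n. 0 \<le> a (Suc n) / real (Suc n)" using assms(2) by simp
  ultimately obtain L where "(\<lambda>n. a (Suc n) / real (Suc n)) \<longlonglongrightarrow> L"
    by (rule decseq_convergent)
  then show ?thesis by (rule convergentI)
qed

lemma simple_function_fibres:
  "simple_function M f \<longleftrightarrow> finite (f ` space M) \<and> (\<forall>k\<in>f ` space M. {x\<in>space M. f x = k} \<in> sets M)"
proof -
  have "f -` {k} \<inter> space M = {x\<in>space M. f x = k}" for k by auto
  then show ?thesis by (simp add: simple_function_def)
qed

section \<open>Invariant measures and the entropy rate of a labelling\<close>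

locale doubling_invariant = real_prob_space +
  assumes sets_M: "sets M = sets S1_borel"
    and distr_doubling: "distr M M doubling = M"
begin

lemma space_M [simp]: "space M = S1"
  using sets_eq_imp_space_eq[OF sets_M] by simp

lemma measurable_M_eq: "measurable M N = measurable S1_borel N" "measurable N M = measurable N S1_borel"
  using sets_M by (auto intro!: measurable_cong_sets)

lemma measurable_doubling_M [measurable]: "doubling \<in> measurable M M"
  unfolding measurable_M_eq by measurable

lemma prob_doubling: "A \<in> events \<Longrightarrow> prob {x\<in>S1. doubling x \<in> A} = prob A"
  using measure_distr[OF measurable_doubling_M, of A] distr_doubling
  by (simp add: vimage_def Int_def conj_commute)

lemma simple_function_doubling:
  assumes "simple_function M f"
  shows "simple_function M (\<lambda>x. f (doubling x))"
proof -
  have "(\<lambda>x. f (doubling x)) ` S1 \<subseteq> f ` S1" by auto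
  moreover have "{x\<in>S1. f (doubling x) = k} \<in> events" for k
  proof -
    have "{x\<in>S1. f (doubling x) = k} = doubling -` {y\<in>S1. f y = k} \<inter> space M" by auto
    also have "\<dots> \<in> events"
      using fibre_sets[OF assms, of k] by (intro measurable_sets[OF measurable_doubling_M]) simp
    finally show ?thesis .
  qed
  ultimately show ?thesis using simple_functionD(1)[OF assms]
    unfolding simple_function_fibres by (auto dest: finite_subset)
qed

lemma fent_doubling:
  assumes "simple_function M f"
  shows "fent M (\<lambda>x. f (doubling x)) = fent M f"
proof -
  have "fent M (\<lambda>x. f (doubling x)) = (\<Sum>k\<in>f`space M. ent_term (prob {y\<in>space M. f (doubling y) = k}))"
    using simple_functionD(1)[OF assms] by (intro fent_eq_sum) auto
  also have "\<dots> = (\<Sum>k\<in>f`space M. ent_term (prob {y\<in>space M. f y = k}))"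
    by (intro sum.cong refl) (subst (2) prob_doubling[symmetric], auto intro: fibre_sets[OF assms, simplified])
  finally show ?thesis by (simp add: fent_eq_sum[OF simple_functionD(1)[OF assms] order.refl])
qed

lemma simple_function_itin: "simple_function M l \<Longrightarrow> simple_function M (itin l n)"
proof (induction n)
  case 0
  then show ?case by (simp add: itin_def[abs_def])
next
  case (Suc n)
  show ?case unfolding itin_Suc[abs_def]
    by (rule simple_function_compose2[OF Suc.prems simple_function_doubling[OF Suc.IH[OF Suc.prems]]])
qed

text \<open>Strong subadditivity for the label at time 0, the label at time n + 1, and the labels at
  times 1 to n as the condition. Invariance identifies the entropy of any block of consecutive times
  with that of the block starting at time 0.\<close>

lemma fent_itin_concave:
  assumes l: "simple_function M l"
  shows "fent M (itin l (Suc (Suc n))) + fent M (itin l n) \<le> 2 * fent M (itin l (Suc n))"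
proof -
  let ?g = "\<lambda>x. l ((doubling ^^ n) (doubling x))" and ?h = "\<lambda>x. itin l n (doubling x)"
  have "simple_function M (\<lambda>x. l ((doubling ^^ n) x))" for n
  proof (induction n)
    case (Suc n)
    from simple_function_doubling[OF this] show ?case by (simp add: funpow_swap1)
  qed (simp add: l)
  note s = simple_function_doubling[OF this] simple_function_doubling[OF simple_function_itin[OF l]]
  have "fent M (\<lambda>x. (l x, ?g x, ?h x)) = fent M (itin l (Suc (Suc n)))"
    by (intro fent_cong) (auto simp: itin_Suc[of l "Suc n"] itin_snoc[of l n "doubling _"])
  moreover have "fent M ?h = fent M (itin l n)"
    by (rule fent_doubling[OF simple_function_itin[OF l]])
  moreover have "fent M (\<lambda>x. (l x, ?h x)) = fent M (itin l (Suc n))"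
    by (intro fent_cong) (auto simp: itin_Suc)
  moreover have "fent M (\<lambda>x. (?g x, ?h x)) = fent M (\<lambda>x. itin l (Suc n) (doubling x))"
    by (intro fent_cong) (auto simp: itin_snoc)
  moreover have "fent M (\<lambda>x. itin l (Suc n) (doubling x)) = fent M (itin l (Suc n))"
    by (rule fent_doubling[OF simple_function_itin[OF l]])
  ultimately show ?thesis
    using fent_strong_subadditive[OF l s, of n n] by simp
qed

lemma fent_const: "fent M (\<lambda>x. c) = 0"
  using prob_space by (subst fent_eq_sum[of "{c}"]) (auto simp: ent_term_eq)

lemma convergent_fent_itin:
  assumes "simple_function M l"
  shows "convergent (\<lambda>n. fent M (itin l (Suc n)) / real (Suc n))"
proof (rule concave_average_convergent)
  show "fent M (itin l 0) = 0" using fent_const[of "[]"] by (simp add: itin_def[abs_def])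
qed (auto intro: fent_nonneg simple_function_itin fent_itin_concave assms)

end

section \<open>Labelling points by the cells of a partition\<close>

definition label :: "real set set \<Rightarrow> real \<Rightarrow> real set" where
  "label P x = (THE A. A \<in> P \<and> x \<in> A)"

context doubling_invariant begin

lemma label_eq_iff:
  assumes "meas_partition M P" "x \<in> S1" "A \<in> P"
  shows "label P x = A \<longleftrightarrow> x \<in> A"
proof -
  have "x \<in> \<Union>P" using assms by (simp add: meas_partition_def)
  then obtain B where B: "B \<in> P" "x \<in> B" by auto
  have uniq: "A' = B" if "A' \<in> P" "x \<in> A'" for A'
    using assms(1) B that unfolding meas_partition_def by (metis disjoint_iff)
  have "label P x = B" unfolding label_def by (rule the_equality) (use B uniq in blast)+
  moreover have "x \<in> A \<longleftrightarrow> A = B" using uniq[OF assms(3)] B by blast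
  ultimately show ?thesis by blast
qed

lemma label_in:
  assumes "meas_partition M P" "x \<in> S1"
  shows "label P x \<in> P" "x \<in> label P x"
proof -
  have "x \<in> \<Union>P" using assms by (simp add: meas_partition_def)
  then obtain B where B: "B \<in> P" "x \<in> B" by auto
  then have "label P x = B" using label_eq_iff[OF assms] by auto
  then show "label P x \<in> P" "x \<in> label P x" using B by auto
qed

lemma simple_function_label:
  assumes P: "meas_partition M P"
  shows "simple_function M (label P)"
proof -
  have "{x\<in>S1. label P x = A} \<in> events" if "A \<in> label P ` S1" for A
  proof -
    have "A \<in> P" using that label_in[OF P] by auto
    moreover from this have "A \<subseteq> S1" "A \<in> events" using P by (auto simp: meas_partition_def)
    ultimately have "{x\<in>S1. label P x = A} = A" using label_eq_iff[OF P] by auto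
    then show ?thesis using \<open>A \<in> events\<close> by simp
  qed
  moreover have "finite (label P ` S1)"
    using label_in[OF P] P by (auto simp: meas_partition_def intro: finite_subset)
  ultimately show ?thesis unfolding simple_function_fibres by auto
qed

text \<open>\<open>part_join\<close> runs over all choices of cells and may contain the empty set,
  which \<open>cells\<close> never does. Apart from it the two families coincide, and the empty set
  contributes entropy 0.\<close>

lemma part_entropy_part_join:
  assumes P: "meas_partition M P"
  shows "part_entropy M (part_join M n P) = fent M (itin (label P) n)"
proof -
  let ?c = "\<lambda>f. space M \<inter> (\<Inter>i<n. (doubling ^^ i) -` f i)"
  have fin: "finite (part_join M n P)"
  proof -
    \<comment> \<open>Only the values of f below n matter; restricting f leaves finitely many choice
      functions.\<close>
    have "part_join M n P \<subseteq> ?c ` ({..<n} \<rightarrow>\<^sub>E P)"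
    proof
      fix C assume "C \<in> part_join M n P"
      then obtain f where f: "C = ?c f" "\<forall>i<n. f i \<in> P" by (auto simp: part_join_def)
      then have "C = ?c (restrict f {..<n})" "restrict f {..<n} \<in> {..<n} \<rightarrow>\<^sub>E P" by auto
      then show "C \<in> ?c ` ({..<n} \<rightarrow>\<^sub>E P)" by blast
    qed
    moreover have "finite (?c ` ({..<n} \<rightarrow>\<^sub>E P))"
      using P by (intro finite_imageI finite_PiE) (auto simp only: meas_partition_def finite_lessThan)
    ultimately show ?thesis by (rule finite_subset)
  qed
  have cell: "?c f = {y\<in>space M. itin (label P) n y = itin (label P) n x}"
    if "\<forall>i<n. f i \<in> P" "x \<in> ?c f" for f x
  proof -
    have *: "(doubling ^^ i) y \<in> f i \<longleftrightarrow> label P ((doubling ^^ i) y) = f i" if "i < n" "y \<in> S1" for i y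
      using label_eq_iff[OF P] that \<open>\<forall>i<n. f i \<in> P\<close> by simp
    have "label P ((doubling ^^ i) x) = f i" if "i < n" for i
      using * that \<open>x \<in> ?c f\<close> by auto
    then show ?thesis using * by (auto simp: itin_def)
  qed
  have "part_join M n P - {{}} = cells M (itin (label P) n)"
  proof (intro equalityI subsetI)
    fix C assume "C \<in> part_join M n P - {{}}"
    then obtain f x where "C = ?c f" "\<forall>i<n. f i \<in> P" "x \<in> C" by (auto simp: part_join_def)
    then show "C \<in> cells M (itin (label P) n)" using cell[of f x] by (auto simp: cells_def)
  next
    fix C assume "C \<in> cells M (itin (label P) n)"
    then obtain x where x: "x \<in> S1" "C = {y\<in>space M. itin (label P) n y = itin (label P) n x}"
      by (auto simp: cells_def)
    let ?f = "\<lambda>i. label P ((doubling ^^ i) x)"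
    have f: "\<forall>i<n. ?f i \<in> P" "x \<in> ?c ?f" using x label_in[OF P] by auto
    then have "C = ?c ?f" using cell[OF f] x(2) by (simp only:)
    then have "C \<in> part_join M n P" using f(1) unfolding part_join_def by (intro CollectI exI[of _ ?f] conjI)
    then show "C \<in> part_join M n P - {{}}" using x by auto
  qed
  moreover have "part_entropy M (part_join M n P) = part_entropy M (part_join M n P - {{}})"
    unfolding part_entropy_def using fin by (intro sum.mono_neutral_right) (auto simp: ent_term_eq)
  ultimately show ?thesis by (simp add: fent_def)
qed

text \<open>Convergence turns the \<open>lim\<close> in the definition into an actual limit.\<close>

lemma ks_entropy_partition_LIMSEQ:
  assumes P: "meas_partition M P"
  shows "(\<lambda>n. fent M (itin (label P) (Suc n)) / real (Suc n)) \<longlonglongrightarrow> ks_entropy_partition M P"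
  using convergent_fent_itin[OF simple_function_label[OF P]]
  unfolding ks_entropy_partition_def part_entropy_part_join[OF P] convergent_LIMSEQ_iff .

end

section \<open>The binary partition is generating\<close>

lemma sets_S1_borel_iff: "A \<in> sets S1_borel \<longleftrightarrow> A \<subseteq> S1 \<and> A \<in> sets borel"
  unfolding S1_borel_def by (rule sets_restrict_space_iff) simp

text \<open>The first binary digit: \<open>False\<close> belongs to the inverse branch z / 2 and
  \<open>True\<close> to (z + 1) / 2.\<close>

definition digit :: "real \<Rightarrow> bool" where
  "digit x \<longleftrightarrow> 1/2 \<le> x"

lemma doubling_digit: "x \<in> S1 \<Longrightarrow> doubling x = 2 * x - (if digit x then 1 else 0)"
  by (auto simp: doubling_def digit_def S1_def frac_unique_iff)

text \<open>As long as the digits agree, \<open>doubling\<close> acts on the difference as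
  multiplication by 2, and distances in \<open>S1\<close> stay below 1.\<close>

lemma itin_digit_close:
  "x \<in> S1 \<Longrightarrow> y \<in> S1 \<Longrightarrow> itin digit n x = itin digit n y \<Longrightarrow> \<bar>x - y\<bar> < (1/2)^n"
proof (induction n arbitrary: x y)
  case 0
  then show ?case by (auto simp: S1_def)
next
  case (Suc n)
  then have "\<bar>doubling x - doubling y\<bar> < (1/2)^n" "digit x = digit y"
    by (auto simp: itin_Suc)
  moreover from this(2) have "doubling x - doubling y = 2 * (x - y)"
    using Suc.prems(1,2) by (simp add: doubling_digit)
  ultimately have "\<bar>2 * (x - y)\<bar> < (1/2)^n" by simp
  then show ?case unfolding abs_mult by simp
qed

text \<open>Here t is the share of an event in one dyadic cell and r the share of points
  misclassified when the whole cell is counted either out or in. A bound linear in r can be summed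
  over cells.\<close>

lemma ent_term_le:
  assumes t: "0 < t" "t \<le> 1" and e: "0 < e" and r: "r = t \<or> r = 1 - t"
  shows "ent_term t \<le> e + r / e"
proof -
  \<comment> \<open>The square root turns ln u <= u - 1 into - t ln t <= 2 s (1 - s), which vanishes
    at both ends; z = s (1 - s) satisfies z^2 <= t and z^2 <= 1 - t.\<close>
  define s where "s = sqrt t"
  have s: "0 < s" "s \<le> 1" "t = s * s" using t by (auto simp: s_def real_sqrt_le_1_iff)
  define z where "z = s * (1 - s)"
  have "ent_term t = 2 * (s * s) * ln (1 / s)"
    using s by (simp add: ent_term_eq ln_mult ln_div)
  also have "\<dots> \<le> 2 * (s * s) * (1 / s - 1)"
    using s by (intro mult_left_mono ln_le_minus_one) auto
  also have "\<dots> = 2 * z" using s by (simp add: z_def field_simps)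
  also have "\<dots> \<le> e + z^2 / e"
  proof -
    have "0 \<le> (e - z)^2 / e" using e by simp
    then show ?thesis using e by (simp add: power2_eq_square field_simps)
  qed
  finally have *: "ent_term t \<le> e + z^2 / e" .
  have "z^2 \<le> r"
  proof -
    have a: "(1 - s)^2 \<le> 1" "s^2 \<le> 1" using s by (auto simp: power_le_one)
    have "z^2 \<le> s^2" using mult_left_mono[OF a(1), of "s^2"] by (simp add: z_def power_mult_distrib)
    moreover have "z^2 \<le> (1-s)^2" using mult_right_mono[OF a(2), of "(1-s)^2"] by (simp add: z_def power_mult_distrib)
    moreover have "(1-s)^2 \<le> 1 - s^2" using mult_left_mono[of s 1 s] s by (simp add: power2_eq_square algebra_simps)
    ultimately show ?thesis using r s(3) by (auto simp: power2_eq_square)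
  qed
  then have "e + z^2 / e \<le> e + r / e" using e by (simp add: divide_right_mono)
  with * show ?thesis by simp
qed

text \<open>The dyadic cells of rank m contained in U. Words that are no itinerary belong to the set
  vacuously; this is harmless because membership is tested only on itineraries of points.\<close>

definition inner_cells :: "real set \<Rightarrow> nat \<Rightarrow> bool list set" where
  "inner_cells U m = {w. \<forall>y\<in>S1. itin digit m y = w \<longrightarrow> y \<in> U}"

section \<open>Approximation of events by dyadic cells\<close>

context doubling_invariant begin

lemma simple_function_events: "simple_function M f \<Longrightarrow> {x\<in>S1. Q (f x)} \<in> events"
  using simple_functionD(2)[of M f "{k. Q k}"] by (simp add: vimage_def Int_def conj_commute)

lemma simple_function_digit: "simple_function M digit"
proof -
  have "{x\<in>S1. digit x = k} \<in> events" for k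
  proof -
    have "{x\<in>space S1_borel. (1/2 \<le> x) = k} \<in> sets S1_borel" by measurable
    then show ?thesis by (simp add: digit_def sets_M)
  qed
  moreover have "finite (digit ` S1)" by (rule finite)
  ultimately show ?thesis unfolding simple_function_fibres space_M by blast
qed

lemmas simple_function_itin_digit = simple_function_itin[OF simple_function_digit]

text \<open>Cells shrink to points, so the inner cells of an open set increase to the set itself;
  continuity from below gives the limit.\<close>

lemma prob_inner_cells_LIMSEQ:
  assumes "open U"
  shows "(\<lambda>m. prob {x\<in>S1. itin digit m x \<in> inner_cells U m}) \<longlonglongrightarrow> prob (U \<inter> S1)"
proof -
  let ?B = "\<lambda>m. {x\<in>S1. itin digit m x \<in> inner_cells U m}"
  have "(\<lambda>m. prob (?B m)) \<longlonglongrightarrow> prob (\<Union>m. ?B m)"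
  proof (rule finite_Lim_measure_incseq)
    show "range ?B \<subseteq> events" by (auto intro: simple_function_events simple_function_itin_digit)
    show "incseq ?B"
    proof (rule incseq_SucI)
      fix n show "?B n \<le> ?B (Suc n)"
        by (clarsimp simp: inner_cells_def) (meson itin_eq_mono le_SucI order.refl)
    qed
  qed
  moreover have "(\<Union>m. ?B m) = U \<inter> S1"
  proof (intro equalityI subsetI)
    fix x assume x: "x \<in> U \<inter> S1"
    then obtain e where e: "e > 0" "ball x e \<subseteq> U" using assms by (auto simp: open_contains_ball)
    obtain m where m: "(1/2)^m < e" using real_arch_pow_inv[of e "1/2"] e by auto
    have "y \<in> U" if "y \<in> S1" "itin digit m y = itin digit m x" for y
      using itin_digit_close[of x y m] that x m e(2) by (auto simp: subset_eq dist_real_def)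
    then show "x \<in> (\<Union>m. ?B m)" using x by (auto simp: inner_cells_def)
  qed (auto simp: inner_cells_def)
  ultimately show ?thesis by simp
qed

text \<open>Outer regularity gives an open set containing A with excess below d / 2, and its inner
  cells lose less than d / 2. Having this for all m beyond N permits one common m for several
  events.\<close>

lemma approx_by_cells:
  assumes A: "A \<in> events" and d: "0 < d"
  obtains N where "\<And>m. N \<le> m \<Longrightarrow> \<exists>W. prob {x\<in>S1. (x \<in> A) \<noteq> (itin digit m x \<in> W)} < d"
proof -
  have id[measurable]: "(\<lambda>x. x) \<in> borel_measurable M" unfolding measurable_M_eq by measurable
  \<comment> \<open>Regularity is a statement about Borel measures on the whole line, so M is pushed
    forward along the inclusion of \<open>S1\<close>.\<close>
  let ?N = "distr M borel (\<lambda>x. x)"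
  interpret N: prob_space ?N by (rule prob_space_distr) measurable
  have SA: "A \<subseteq> S1" using sets.sets_into_space[OF A] by simp
  have borelA: "A \<in> sets borel"
    using A by (simp add: sets_M sets_S1_borel_iff)
  have N: "measure ?N B = prob (B \<inter> S1)" if "B \<in> sets borel" for B
    using measure_distr[OF id that] by simp
  have "emeasure ?N A = (INF U\<in>{U. A \<subseteq> U \<and> open U}. emeasure ?N U)"
    by (rule outer_regular) (auto simp: borelA)
  moreover have "emeasure ?N A < emeasure ?N A + ennreal (d/2)"
    using d by (simp add: N.emeasure_eq_measure ennreal_plus[symmetric] ennreal_less_iff del: ennreal_plus)
  ultimately obtain U where U: "A \<subseteq> U" "open U" "emeasure ?N U < emeasure ?N A + ennreal (d/2)"
    by (auto simp: INF_less_iff)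
  have Ub: "U \<inter> S1 \<in> events"
    using U(2) by (simp add: sets_M sets_S1_borel_iff)
  have "measure ?N U < measure ?N A + d/2"
    using U(3) d by (simp add: N.emeasure_eq_measure ennreal_plus[symmetric] ennreal_less_iff del: ennreal_plus)
  then have 1: "prob (U \<inter> S1) < prob A + d/2"
    using N[OF borelA] N[of U] U(2) SA by (simp add: Int_absorb2)
  have "eventually (\<lambda>m. prob (U \<inter> S1) - d/2 < prob {x\<in>S1. itin digit m x \<in> inner_cells U m}) sequentially"
    using order_tendstoD(1)[OF prob_inner_cells_LIMSEQ[OF U(2)]] d by simp
  then obtain N where N: "\<And>m. m \<ge> N \<Longrightarrow> prob (U \<inter> S1) - d/2 < prob {x\<in>S1. itin digit m x \<in> inner_cells U m}"
    unfolding eventually_sequentially by blast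
  show ?thesis
  proof (rule that[of N])
    fix m assume m: "N \<le> m"
    let ?B = "{x\<in>S1. itin digit m x \<in> inner_cells U m}"
    have B: "?B \<in> events" "?B \<subseteq> U \<inter> S1"
      by (auto intro: simple_function_events simple_function_itin_digit simp: inner_cells_def)
    have "prob {x\<in>S1. (x \<in> A) \<noteq> (itin digit m x \<in> inner_cells U m)} \<le> prob ((U \<inter> S1 - A) \<union> (U \<inter> S1 - ?B))"
      using U(1) B A Ub by (intro finite_measure_mono) auto
    also have "\<dots> \<le> prob (U \<inter> S1 - A) + prob (U \<inter> S1 - ?B)"
      using B A Ub by (intro measure_Un_le) auto
    also have "\<dots> = (prob (U \<inter> S1) - prob A) + (prob (U \<inter> S1) - prob ?B)"
      using B A Ub U(1) SA by (simp add: finite_measure_Diff)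
    also have "\<dots> < d" using 1 N[OF m] by simp
    finally show "\<exists>W. prob {x\<in>S1. (x \<in> A) \<noteq> (itin digit m x \<in> W)} < d" by blast
  qed
qed

text \<open>The left side is the contribution of the fibre f = a to H(f | g). In each cell g = u the
  misclassified part has relative size t or 1 - t; summing \<open>ent_term_le\<close> over u bounds
  the total by e + e^2 / e.\<close>

lemma cond_fent_fibre_le:
  assumes f: "simple_function M f" and g: "simple_function M g" and e: "0 < e"
    and W: "prob {x\<in>S1. (f x = a) \<noteq> (g x \<in> W)} \<le> e^2"
  shows "(\<Sum>u\<in>g`S1. ent_term (prob {x\<in>S1. f x = a \<and> g x = u})
      + prob {x\<in>S1. f x = a \<and> g x = u} * ln (prob {x\<in>S1. g x = u})) \<le> 2 * e"
proof -
  let ?P = "\<lambda>u. prob {x\<in>S1. f x = a \<and> g x = u}" and ?S = "\<lambda>u. prob {x\<in>S1. g x = u}"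
  let ?D = "\<lambda>u. prob {x\<in>S1. ((f x = a) \<noteq> (g x \<in> W)) \<and> g x = u}"
  have ev: "{x\<in>S1. Q (f x) (g x)} \<in> events" for Q
    using simple_function_events[OF simple_function_Pair[OF f g], of "\<lambda>(x,y). Q x y"] by simp
  have step: "ent_term (?P u) + ?P u * ln (?S u) \<le> e * ?S u + ?D u / e" for u
  proof (cases "?P u = 0")
    case True
    then show ?thesis using e by (simp add: ent_term_eq)
  next
    case False
    then have P: "?P u > 0" by (simp add: zero_less_measure_iff)
    have PS: "?P u \<le> ?S u" by (intro finite_measure_mono ev) auto
    then have S: "?S u > 0" using P by linarith
    let ?t = "?P u / ?S u"
    have D: "?D u / ?S u = ?t \<or> ?D u / ?S u = 1 - ?t"
    proof (cases "u \<in> W")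
      case True
      then have "{x\<in>S1. ((f x = a) \<noteq> (g x \<in> W)) \<and> g x = u} = {x\<in>S1. g x = u} - {x\<in>S1. f x = a \<and> g x = u}"
        by auto
      moreover have "prob ({x\<in>S1. g x = u} - {x\<in>S1. f x = a \<and> g x = u}) = ?S u - ?P u"
        by (intro finite_measure_Diff ev) auto
      ultimately show ?thesis using S by (simp add: diff_divide_distrib)
    next
      case False
      then have "{x\<in>S1. ((f x = a) \<noteq> (g x \<in> W)) \<and> g x = u} = {x\<in>S1. f x = a \<and> g x = u}" by auto
      then show ?thesis by simp
    qed
    have "ent_term (?P u) + ?P u * ln (?S u) = ?S u * ent_term ?t"
      using P S by (simp add: ent_term_eq ln_div algebra_simps)
    also have "\<dots> \<le> ?S u * (e + ?D u / ?S u / e)"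
      using P S PS by (intro mult_left_mono ent_term_le D e) auto
    also have "\<dots> = e * ?S u + ?D u / e" using S by (simp add: field_simps)
    finally show ?thesis .
  qed
  have fin: "finite (g`S1)" using simple_functionD(1)[OF g] by simp
  have sS: "(\<Sum>u\<in>g`S1. ?S u) = 1"
    using prob_eq_sum_fibres[OF g fin _ sets.top] prob_space by simp
  have sD: "(\<Sum>u\<in>g`S1. ?D u) = prob {x\<in>S1. (f x = a) \<noteq> (g x \<in> W)}"
    by (subst prob_eq_sum_fibres[OF g fin]) (auto intro!: sum.cong arg_cong[where f=prob] ev)
  have "(\<Sum>u\<in>g`S1. ent_term (?P u) + ?P u * ln (?S u)) \<le> (\<Sum>u\<in>g`S1. e * ?S u + ?D u / e)"
    by (intro sum_mono step)
  also have "\<dots> = e * (\<Sum>u\<in>g`S1. ?S u) + (\<Sum>u\<in>g`S1. ?D u) / e"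
    by (simp add: sum.distrib sum_distrib_left sum_divide_distrib)
  also have "\<dots> \<le> e + e^2 / e" unfolding sS sD using W e by (intro add_mono divide_right_mono) auto
  also have "\<dots> = 2 * e" using e by (simp add: power2_eq_square)
  finally show ?thesis .
qed

text \<open>In words of information theory, H(f | first m digits) becomes arbitrarily small.\<close>

lemma cond_fent_small:
  assumes f: "simple_function M f" and e: "0 < e"
  obtains m where "fent M (\<lambda>x. (f x, itin digit m x)) \<le> fent M (itin digit m) + e"
proof -
  have fin: "finite (f`S1)" using simple_functionD(1)[OF f] by simp
  have "S1 \<noteq> {}" by (auto simp: S1_def)
  then have card: "0 < card (f`S1)" using fin by (simp add: card_gt_0_iff)
  \<comment> \<open>Each of the finitely many fibres contributes at most 2 * d once it is
    approximated up to d^2, and together these contributions make e.\<close>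
  define d where "d = e / (2 * card (f`S1))"
  have d: "0 < d" using e card by (simp add: d_def)
  have "\<exists>N. \<forall>m\<ge>N. \<exists>W. prob {x\<in>S1. (f x = a) \<noteq> (itin digit m x \<in> W)} < d^2" for a
  proof -
    have "{x\<in>S1. f x = a} \<in> events" by (rule simple_function_events[OF f])
    then obtain N where N: "\<And>m. N \<le> m \<Longrightarrow> \<exists>W. prob {x\<in>S1. (x \<in> {x\<in>S1. f x = a}) \<noteq> (itin digit m x \<in> W)} < d^2"
      using d by (elim approx_by_cells[where d="d^2"]) auto
    moreover have "{x\<in>S1. (x \<in> {x\<in>S1. f x = a}) \<noteq> Q x} = {x\<in>S1. (f x = a) \<noteq> Q x}" for Q by auto
    ultimately show ?thesis by auto
  qed
  then have "\<exists>N. \<forall>a. \<forall>m\<ge>N a. \<exists>W. prob {x\<in>S1. (f x = a) \<noteq> (itin digit m x \<in> W)} < d^2"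
    by (intro choice allI)
  then obtain N where N: "\<And>a m. N a \<le> m \<Longrightarrow> \<exists>W. prob {x\<in>S1. (f x = a) \<noteq> (itin digit m x \<in> W)} < d^2"
    by blast
  define m where "m = Max (N ` f ` S1)"
  let ?g = "itin digit m"
  have g: "simple_function M ?g" by (rule simple_function_itin_digit)
  have fing: "finite (?g`S1)" using simple_functionD(1)[OF g] by simp
  let ?P = "\<lambda>a u. prob {x\<in>S1. f x = a \<and> ?g x = u}" and ?S = "\<lambda>u. prob {x\<in>S1. ?g x = u}"
  have "(\<Sum>u\<in>?g`S1. ent_term (?P a u) + ?P a u * ln (?S u)) \<le> 2 * d" if a: "a \<in> f`S1" for a
  proof -
    have "N a \<le> m" unfolding m_def using a fin by (intro Max_ge) auto
    then obtain W where "prob {x\<in>S1. (f x = a) \<noteq> (?g x \<in> W)} < d^2" using N by blast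
    then show ?thesis by (intro cond_fent_fibre_le[where W=W] f g d) auto
  qed
  then have "(\<Sum>a\<in>f`S1. \<Sum>u\<in>?g`S1. ent_term (?P a u) + ?P a u * ln (?S u)) \<le> card (f`S1) * (2 * d)"
    by (rule sum_bounded_above)
  also have "\<dots> = e" using card by (simp add: d_def)
  finally have 1: "(\<Sum>a\<in>f`S1. \<Sum>u\<in>?g`S1. ent_term (?P a u) + ?P a u * ln (?S u)) \<le> e" .
  have "?S u = (\<Sum>a\<in>f`S1. ?P a u)" for u
    using prob_eq_sum_fibres[OF f fin _ simple_function_events[OF g, of "\<lambda>v. v = u"]]
    by (simp add: conj_ac)
  then have "(\<Sum>u\<in>?g`S1. ?S u * ln (?S u)) = (\<Sum>u\<in>?g`S1. \<Sum>a\<in>f`S1. ?P a u * ln (?S u))"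
    by (simp only: sum_distrib_right[symmetric])
  then have 2: "(\<Sum>a\<in>f`S1. \<Sum>u\<in>?g`S1. ?P a u * ln (?S u)) = - fent M ?g"
    unfolding fent_eq_sum[OF simple_functionD(1)[OF g] order.refl]
    by (subst sum.swap) (simp add: ent_term_eq sum_negf)
  show ?thesis
    using 1 2 by (intro that[of m]) (simp add: fent_Pair[OF f g] sum.distrib)
qed

text \<open>Conditioning on the finer function gives less entropy, H(f | g) <= H(f | h), because
  adjoining h to g changes no fibre.\<close>

lemma fent_refine:
  assumes f: "simple_function M f" and g: "simple_function M g" and h: "simple_function M h"
    and gh: "\<And>x y. x \<in> S1 \<Longrightarrow> y \<in> S1 \<Longrightarrow> g x = g y \<Longrightarrow> h x = h y"
  shows "fent M (\<lambda>x. (f x, g x)) + fent M h \<le> fent M (\<lambda>x. (f x, h x)) + fent M g"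
proof -
  have eq: "(g x = g y \<and> h x = h y) = (g x = g y)" if "x \<in> space M" "y \<in> space M" for x y
    using gh[of x y] that by (cases "g x = g y") simp_all
  have "fent M (\<lambda>x. (f x, g x, h x)) = fent M (\<lambda>x. (f x, g x))"
    by (rule fent_cong) (simp only: prod.inject eq)
  moreover have "fent M (\<lambda>x. (g x, h x)) = fent M g"
    by (rule fent_cong) (simp only: prod.inject eq)
  ultimately show ?thesis using fent_strong_subadditive[OF f g h] by simp
qed

text \<open>With n + m digits known, at each of the times 0 to n - 1 the next m digits are known as
  well, so each label costs at most e. The induction splits off the label at time 0 and moves the
  others back by invariance.\<close>

lemma cond_fent_itin_le:
  assumes l: "simple_function M l"
    and e: "fent M (\<lambda>x. (l x, itin digit m x)) \<le> fent M (itin digit m) + e"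
  shows "fent M (\<lambda>x. (itin l n x, itin digit (n + m) x)) \<le> fent M (itin digit (n + m)) + n * e"
proof (induction n)
  case 0
  have "fent M (\<lambda>x. (itin l 0 x, itin digit (0 + m) x)) = fent M (itin digit m)"
    by (intro fent_cong) auto
  then show ?case by simp
next
  case (Suc n)
  let ?D = "itin digit (Suc n + m)" and ?P = "\<lambda>x. itin l n (doubling x)" and ?E = "\<lambda>x. itin digit (n + m) (doubling x)"
  note P = simple_function_doubling[OF simple_function_itin[OF l]]
  note E = simple_function_doubling[OF simple_function_itin_digit]
  have 0: "fent M (\<lambda>x. (itin l (Suc n) x, ?D x)) = fent M (\<lambda>x. (l x, ?P x, ?D x))"
    by (intro fent_cong) (auto simp: itin_Suc)
  have 1: "fent M (\<lambda>x. (l x, ?P x, ?D x)) + fent M ?D \<le> fent M (\<lambda>x. (l x, ?D x)) + fent M (\<lambda>x. (?P x, ?D x))"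
    by (rule fent_strong_subadditive[OF l P simple_function_itin_digit])
  have 2: "fent M (\<lambda>x. (l x, ?D x)) + fent M (itin digit m) \<le> fent M (\<lambda>x. (l x, itin digit m x)) + fent M ?D"
    by (rule fent_refine[OF l simple_function_itin_digit simple_function_itin_digit])
       (erule itin_eq_mono, simp)
  have 3: "fent M (\<lambda>x. (?P x, ?D x)) + fent M ?E \<le> fent M (\<lambda>x. (?P x, ?E x)) + fent M ?D"
    by (rule fent_refine[OF P simple_function_itin_digit E]) (simp add: itin_Suc)
  have 4: "fent M ?E = fent M (itin digit (n + m))"
    by (rule fent_doubling[OF simple_function_itin_digit])
  have 5: "fent M (\<lambda>x. (?P x, ?E x)) = fent M (\<lambda>x. (itin l n x, itin digit (n + m) x))"
    by (rule fent_doubling[OF simple_function_Pair[OF simple_function_itin[OF l] simple_function_itin_digit]])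
  show ?case using 0 1 2 3 4 5 Suc e by (simp add: algebra_simps)
qed

text \<open>The m additional digits do not change the rate of growth, and each label costs at most e
  more than the digits.\<close>

lemma LIMSEQ_fent_itin_le:
  assumes l: "simple_function M l"
    and L: "(\<lambda>n. fent M (itin l (Suc n)) / real (Suc n)) \<longlonglongrightarrow> L"
    and K: "(\<lambda>n. fent M (itin digit (Suc n)) / real (Suc n)) \<longlonglongrightarrow> K"
  shows "L \<le> K"
proof (rule field_le_epsilon)
  fix e :: real assume e: "0 < e"
  obtain m where m: "fent M (\<lambda>x. (l x, itin digit m x)) \<le> fent M (itin digit m) + e"
    using cond_fent_small[OF l e] .
  have le: "fent M (itin l (Suc n)) / real (Suc n) \<le>
      fent M (itin digit (Suc (n + m))) / real (Suc (n + m)) * (real (Suc (n + m)) / real (Suc n)) + e" for n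
  proof -
    have "fent M (itin l (Suc n)) \<le> fent M (\<lambda>x. (itin l (Suc n) x, itin digit (Suc n + m) x))"
      by (rule fent_mono[OF simple_function_itin[OF l] simple_function_itin_digit])
    also have "\<dots> \<le> fent M (itin digit (Suc n + m)) + real (Suc n) * e"
      by (rule cond_fent_itin_le[OF l m])
    finally have "fent M (itin l (Suc n)) \<le> fent M (itin digit (Suc (n + m))) + real (Suc n) * e" by simp
    then have "fent M (itin l (Suc n)) / real (Suc n) \<le> (fent M (itin digit (Suc (n + m))) + real (Suc n) * e) / real (Suc n)"
      by (rule divide_right_mono) simp
    then show ?thesis by (simp add: add_divide_distrib del: of_nat_Suc)
  qed
  have q: "(\<lambda>n. real (Suc (n + m)) / real (Suc n)) \<longlonglongrightarrow> 1"
  proof -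
    have "(\<lambda>n. 1 + real m * inverse (real (Suc n))) \<longlonglongrightarrow> 1 + real m * 0"
      by (intro tendsto_intros LIMSEQ_inverse_real_of_nat)
    moreover have "1 + real m * inverse (real (Suc n)) = real (Suc (n + m)) / real (Suc n)" for n
      by (simp add: field_simps)
    ultimately show ?thesis by simp
  qed
  have "(\<lambda>n. fent M (itin digit (Suc (n + m))) / real (Suc (n + m)) * (real (Suc (n + m)) / real (Suc n)) + e) \<longlonglongrightarrow> K * 1 + e"
    by (intro tendsto_intros q LIMSEQ_ignore_initial_segment[OF K])
  from tendsto_le[OF _ this L] le show "L \<le> K + e" by simp
qed

text \<open>The generator theorem: the supremum over partitions is a maximum, attained by the two
  half intervals, whose labels separate the same points as \<open>digit\<close>.\<close>

lemma ks_entropy_LIMSEQ: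
  "(\<lambda>n. fent M (itin digit (Suc n)) / real (Suc n)) \<longlonglongrightarrow> ks_entropy M"
proof -
  obtain K where K: "(\<lambda>n. fent M (itin digit (Suc n)) / real (Suc n)) \<longlonglongrightarrow> K"
    using convergent_fent_itin[OF simple_function_digit] by (auto simp: convergent_def)
  let ?D = "{{0..<1/2}, {1/2..<1}} :: real set set"
  have "{x\<in>S1. \<not> digit x} = {0..<1/2}" "{x\<in>S1. digit x} = {1/2..<1}"
    by (auto simp: digit_def S1_def)
  then have "{0..<1/2} \<in> events" "{1/2..<1} \<in> events"
    using simple_function_events[OF simple_function_digit, of Not]
      simple_function_events[OF simple_function_digit, of "\<lambda>x. x"] by simp_all
  then have D: "meas_partition M ?D" by (auto simp: meas_partition_def S1_def)
  have lab: "label ?D x = label ?D y \<longleftrightarrow> digit x = digit y" if "x \<in> S1" "y \<in> S1" for x y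
  proof -
    have "label ?D z = (if digit z then {1/2..<1} else {0..<1/2})" if "z \<in> S1" for z
      using that by (auto simp: label_eq_iff[OF D that] digit_def S1_def)
    moreover have "{1/2..<1} \<noteq> {0..<1/2::real}" by (metis atLeastLessThan_iff divide_less_eq_1_pos less_irrefl order.refl one_less_numeral_iff semiring_norm(76) zero_less_numeral)
    ultimately show ?thesis using that by auto
  qed
  have "fent M (itin (label ?D) n) = fent M (itin digit n)" for n
    by (intro fent_cong) (auto simp: itin_def lab)
  then have KD: "ks_entropy_partition M ?D = K"
    using ks_entropy_partition_LIMSEQ[OF D] K by (auto intro: LIMSEQ_unique)
  have "ks_entropy_partition M P \<le> K" if "meas_partition M P" for P
    by (rule LIMSEQ_fent_itin_le[OF simple_function_label[OF that] ks_entropy_partition_LIMSEQ[OF that] K])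
  then have "ks_entropy M = K"
    unfolding ks_entropy_def using D KD by (intro cSup_eq_maximum) auto
  then show ?thesis using K by simp
qed

end

section \<open>Jacobians and entropy\<close>

lemma branch_in_S1 [simp]: "z \<in> S1 \<Longrightarrow> z / 2 \<in> S1" "z \<in> S1 \<Longrightarrow> (z + 1) / 2 \<in> S1"
  by (auto simp: S1_def)

lemma digit_branch [simp]: "z \<in> S1 \<Longrightarrow> \<not> digit (z / 2)" "z \<in> S1 \<Longrightarrow> digit ((z + 1) / 2)"
  by (auto simp: S1_def digit_def)

lemma doubling_branch [simp]: "z \<in> S1 \<Longrightarrow> doubling (z / 2) = z" "z \<in> S1 \<Longrightarrow> doubling ((z + 1) / 2) = z"
proof -
  show "doubling (z / 2) = z" if "z \<in> S1" using that by (simp add: doubling_digit)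
  show "doubling ((z + 1) / 2) = z" if "z \<in> S1"
    using doubling_digit[OF branch_in_S1(2)[OF that]] digit_branch(2)[OF that] by (simp only: if_True) (simp add: field_simps)
qed

lemma branch_doubling: "x \<in> S1 \<Longrightarrow> x = (if digit x then (doubling x + 1) / 2 else doubling x / 2)"
  by (simp add: doubling_digit)

lemma doubling_eq_iff: "x \<in> S1 \<Longrightarrow> z \<in> S1 \<Longrightarrow> doubling x = z \<longleftrightarrow> x = z / 2 \<or> x = (z + 1) / 2"
  by (metis branch_doubling doubling_branch)

lemma measurable_branch [measurable]:
  "(\<lambda>z. z / 2) \<in> measurable S1_borel S1_borel" "(\<lambda>z. (z + 1) / 2) \<in> measurable S1_borel S1_borel"
proof -
  have *: "f \<in> measurable S1_borel S1_borel" if "f \<in> borel_measurable S1_borel" "f \<in> S1 \<rightarrow> S1" for f :: "real \<Rightarrow> real"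
    using that by (subst (2) S1_borel_def) (intro measurable_restrict_space2, auto)
  show "(\<lambda>z. z / 2) \<in> measurable S1_borel S1_borel" "(\<lambda>z. (z + 1) / 2) \<in> measurable S1_borel S1_borel"
    by (rule *; auto)+
qed

text \<open>\<open>J_int\<close> is the fixed point equation of the dual Ruelle operator, tested on
  all nonnegative measurable functions and written through the two inverse branches. J need only be
  measurable, but it is normalised on every fibre.\<close>

locale jacobian = real_prob_space +
  fixes J :: "real \<Rightarrow> real"
  assumes sets_M': "sets M = sets S1_borel"
    and J_meas [measurable]: "J \<in> borel_measurable S1_borel"
    and J_nonneg: "x \<in> S1 \<Longrightarrow> 0 \<le> J x"
    and J_sum: "z \<in> S1 \<Longrightarrow> J (z / 2) + J ((z + 1) / 2) = 1"
    and J_int: "f \<in> borel_measurable S1_borel \<Longrightarrow> (\<integral>\<^sup>+ x. f x \<partial>M) =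
      (\<integral>\<^sup>+ z. ennreal (J (z / 2)) * f (z / 2) + ennreal (J ((z + 1) / 2)) * f ((z + 1) / 2) \<partial>M)"
begin

lemma J_sum_ennreal: "z \<in> S1 \<Longrightarrow> ennreal (J (z / 2)) + ennreal (J ((z + 1) / 2)) = 1"
  using J_sum[of z] by (simp add: ennreal_plus[symmetric] J_nonneg del: ennreal_plus)

text \<open>For the indicator of a preimage of A both inverse branches yield the indicator of A,
  with weights adding up to 1.\<close>

sublocale doubling_invariant
proof
  have sp: "space M = S1" using sets_eq_imp_space_eq[OF sets_M'] by simp
  have meq: "measurable M N = measurable S1_borel N" "measurable N M = measurable N S1_borel" for N :: "real measure"
    using sets_M' by (auto intro!: measurable_cong_sets)
  show "sets M = sets S1_borel" by (fact sets_M')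
  show "distr M M doubling = M"
  proof (rule measure_eqI)
    fix A assume "A \<in> sets (distr M M doubling)"
    then have A[measurable]: "A \<in> sets S1_borel" by (simp add: sets_M')
    have [measurable]: "doubling \<in> measurable M M" unfolding meq by measurable
    have [measurable]: "A \<in> sets M" using A by (simp add: sets_M')
    have "emeasure (distr M M doubling) A = (\<integral>\<^sup>+ x. indicator A x \<partial>distr M M doubling)" by simp
    also have "\<dots> = (\<integral>\<^sup>+ x. indicator A (doubling x) \<partial>M)" by (rule nn_integral_distr) measurable
    also have "\<dots> = (\<integral>\<^sup>+ z. ennreal (J (z / 2)) * indicator A (doubling (z / 2)) +
        ennreal (J ((z + 1) / 2)) * indicator A (doubling ((z + 1) / 2)) \<partial>M)"
      by (rule J_int) measurable
    also have "\<dots> = (\<integral>\<^sup>+ z. indicator A z \<partial>M)"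
    proof (rule nn_integral_cong)
      fix z assume "z \<in> space M"
      then have z: "z \<in> S1" by (simp add: sp)
      show "ennreal (J (z / 2)) * indicator A (doubling (z / 2)) +
        ennreal (J ((z + 1) / 2)) * indicator A (doubling ((z + 1) / 2)) = indicator A z"
        using J_sum_ennreal[OF z] z by (simp add: distrib_right[symmetric])
    qed
    also have "\<dots> = emeasure M A" by simp
    finally show "emeasure (distr M M doubling) A = emeasure M A" .
  qed simp
qed

lemma J_le_1: "x \<in> S1 \<Longrightarrow> J x \<le> 1"
proof -
  assume x: "x \<in> S1"
  have "J (doubling x / 2) + J ((doubling x + 1) / 2) = 1" by (rule J_sum) simp
  moreover have "0 \<le> J (doubling x / 2)" "0 \<le> J ((doubling x + 1) / 2)" by (auto intro!: J_nonneg)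
  ultimately show "J x \<le> 1" using branch_doubling[OF x] by (auto split: if_splits)
qed

text \<open>\<open>J_int\<close> gives each point of the zero set of J the weight 0.\<close>

lemma AE_J_pos: "AE x in M. 0 < J x"
proof -
  have [measurable]: "{x\<in>S1. J x = 0} \<in> sets S1_borel"
    using measurable_sets[OF J_meas, of "{0}"] by (simp add: vimage_def Int_def conj_commute)
  have "emeasure M {x\<in>S1. J x = 0} = (\<integral>\<^sup>+ x. indicator {x\<in>S1. J x = 0} x \<partial>M)"
    by (simp add: sets_M)
  also have "\<dots> = (\<integral>\<^sup>+ z. ennreal (J (z / 2)) * indicator {x\<in>S1. J x = 0} (z / 2) +
        ennreal (J ((z + 1) / 2)) * indicator {x\<in>S1. J x = 0} ((z + 1) / 2) \<partial>M)"
    by (rule J_int) measurable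
  also have "\<dots> = (\<integral>\<^sup>+ z. 0 \<partial>M)"
    by (intro nn_integral_cong) (auto simp: indicator_def)
  finally have "{x\<in>S1. J x = 0} \<in> null_sets M" by (auto simp: null_sets_def sets_M)
  from AE_not_in[OF this] AE_space show ?thesis
    by eventually_elim (use J_nonneg in \<open>force simp: less_le\<close>)
qed

text \<open>J may come arbitrarily close to 0, but \<open>J_int\<close> supplies the weight J, and -
  t ln t <= 1 - t. The two bounds on a fibre sum to 2 - 1, so the integral of - ln J is at most
  1.\<close>

lemma integrable_ln_J: "integrable M (\<lambda>x. ln (J x))"
proof -
  have [measurable]: "J \<in> borel_measurable M" unfolding measurable_M_eq by measurable
  have le: "ennreal (J x) * ennreal (- ln (J x)) \<le> ennreal (1 - J x)" if "x \<in> S1" for x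
  proof (cases "J x = 0")
    case False
    then have J: "0 < J x" using J_nonneg[OF that] by simp
    have "J x * - ln (J x) = J x * ln (1 / J x)" using J by (simp add: ln_div)
    also have "\<dots> \<le> J x * (1 / J x - 1)" using J by (intro mult_left_mono ln_le_minus_one) auto
    also have "\<dots> = 1 - J x" using J by (simp add: field_simps)
    finally show ?thesis using J by (simp add: ennreal_mult'[symmetric] ennreal_leI)
  qed simp
  have "(\<integral>\<^sup>+ x. ennreal (- ln (J x)) \<partial>M) = (\<integral>\<^sup>+ z. ennreal (J (z / 2)) * ennreal (- ln (J (z / 2))) +
        ennreal (J ((z + 1) / 2)) * ennreal (- ln (J ((z + 1) / 2))) \<partial>M)"
    by (rule J_int) measurable
  also have "\<dots> \<le> (\<integral>\<^sup>+ z. ennreal (1 - J (z / 2)) + ennreal (1 - J ((z + 1) / 2)) \<partial>M)"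
    by (intro nn_integral_mono add_mono le) auto
  also have "\<dots> = (\<integral>\<^sup>+ z. 1 \<partial>M)"
  proof (rule nn_integral_cong)
    fix z assume z: "z \<in> space M"
    then show "ennreal (1 - J (z / 2)) + ennreal (1 - J ((z + 1) / 2)) = 1"
      using J_sum[of z] by (simp add: ennreal_plus[symmetric] J_le_1 del: ennreal_plus)
  qed
  also have "\<dots> < \<infinity>" using emeasure_space_1 by simp
  finally have fin: "(\<integral>\<^sup>+ x. ennreal (- ln (J x)) \<partial>M) < \<infinity>" .
  have "AE x in M. 0 \<le> - ln (J x)"
    using AE_J_pos AE_space by eventually_elim (simp add: J_le_1)
  with fin have "integrable M (\<lambda>x. - ln (J x))" by (intro integrableI_nonneg) auto
  then show ?thesis by simp
qed

lemma cross_entropy_ge: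
  assumes q [measurable]: "q \<in> borel_measurable S1_borel"
    and q0: "\<And>x. x \<in> S1 \<Longrightarrow> 0 \<le> q x"
    and qs: "\<And>z. z \<in> S1 \<Longrightarrow> q (z / 2) + q ((z + 1) / 2) \<le> 1"
    and qpos: "AE x in M. 0 < q x" and int: "integrable M (\<lambda>x. ln (q x))"
  shows "(\<integral>x. - ln (J x) \<partial>M) \<le> (\<integral>x. - ln (q x) \<partial>M)"
proof -
  have [measurable]: "J \<in> borel_measurable M" "q \<in> borel_measurable M" unfolding measurable_M_eq by measurable
  \<comment> \<open>Only an inequality, since the left side is 0 wherever J is 0.\<close>
  have le: "ennreal (J x) * ennreal (q x / J x) \<le> ennreal (q x)" if "x \<in> S1" for x
    using J_nonneg[OF that] q0[OF that] by (cases "J x = 0") (auto simp: ennreal_mult'[symmetric])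
  have "(\<integral>\<^sup>+ x. ennreal (q x / J x) \<partial>M) = (\<integral>\<^sup>+ z. ennreal (J (z / 2)) * ennreal (q (z / 2) / J (z / 2)) +
        ennreal (J ((z + 1) / 2)) * ennreal (q ((z + 1) / 2) / J ((z + 1) / 2)) \<partial>M)"
    by (rule J_int) measurable
  also have "\<dots> \<le> (\<integral>\<^sup>+ z. ennreal (q (z / 2)) + ennreal (q ((z + 1) / 2)) \<partial>M)"
    by (intro nn_integral_mono add_mono le) auto
  also have "\<dots> \<le> (\<integral>\<^sup>+ z. 1 \<partial>M)"
    by (intro nn_integral_mono) (auto simp: ennreal_plus[symmetric] q0 qs simp del: ennreal_plus)
  finally have le1: "(\<integral>\<^sup>+ x. ennreal (q x / J x) \<partial>M) \<le> 1" using emeasure_space_1 by simp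
  have nn: "AE x in M. 0 \<le> q x / J x"
    using AE_space by eventually_elim (simp add: q0 J_nonneg)
  have i: "integrable M (\<lambda>x. q x / J x)"
    using le1 nn by (intro integrableI_nonneg) (auto simp: less_top[symmetric] top_unique)
  have "(\<integral>x. q x / J x \<partial>M) \<le> 1"
    using le1 nn_integral_eq_integral[OF i nn] by (simp add: ennreal_le_1)
  have "(\<integral>x. ln (q x) - ln (J x) \<partial>M) \<le> (\<integral>x. q x / J x - 1 \<partial>M)"
  proof (rule integral_mono_AE)
    show "AE x in M. ln (q x) - ln (J x) \<le> q x / J x - 1"
      using qpos AE_J_pos
    proof eventually_elim
      case (elim x)
      then show ?case using ln_le_minus_one[of "q x / J x"] by (simp add: ln_div)
    qed
  qed (use i int integrable_ln_J in auto)
  also have "\<dots> \<le> 0" using i \<open>(\<integral>x. q x / J x \<partial>M) \<le> 1\<close> prob_space by simp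
  finally show ?thesis using int integrable_ln_J by simp
qed

end

section \<open>Cylinder measures and increments of the digit entropy\<close>

context doubling_invariant begin

definition cyl :: "nat \<Rightarrow> real \<Rightarrow> real" where
  "cyl n x = prob {y\<in>S1. itin digit n y = itin digit n x}"

lemma cyl_doubling: "cyl n (doubling x) = prob {y\<in>S1. itin digit n (doubling y) = itin digit n (doubling x)}"
  unfolding cyl_def
  using prob_doubling[OF simple_function_events[OF simple_function_itin_digit, of "\<lambda>v. v = itin digit n (doubling x)" n]] by simp

lemma simple_function_cyl: "simple_function M (cyl n)"
  using simple_function_compose1[OF simple_function_itin_digit, of "\<lambda>v. prob {y\<in>S1. itin digit n y = v}"]
  by (simp add: cyl_def[abs_def])

lemma fent_itin_eq_integral: "fent M (itin digit n) = (\<integral>x. - ln (cyl n x) \<partial>M)"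
  using fent_eq_integral[OF simple_function_itin_digit] by (simp add: cyl_def)

lemma fent_itin_eq_integral': "fent M (itin digit n) = (\<integral>x. - ln (cyl n (doubling x)) \<partial>M)"
  using fent_eq_integral[OF simple_function_doubling[OF simple_function_itin_digit]]
  by (simp add: cyl_doubling fent_doubling[OF simple_function_itin_digit])

lemma AE_cyl_pos: "AE x in M. 0 < cyl n x"
  using AE_fibre_pos[OF simple_function_itin_digit] by (simp add: cyl_def)

lemma cyl_Suc_le: "cyl (Suc n) x \<le> cyl n (doubling x)"
  unfolding cyl_doubling unfolding cyl_def
  by (intro finite_measure_mono simple_function_events[OF simple_function_doubling[OF simple_function_itin_digit]])
     (auto simp: itin_Suc)

lemma cyl_nonneg: "0 \<le> cyl n x"
  by (simp add: cyl_def)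

text \<open>The conditional probability of the first digit of x given the n digits after it, a
  finite-stage substitute for the Jacobian. Its value is 0 where the denominator is 0.\<close>

definition cyl_ratio :: "nat \<Rightarrow> real \<Rightarrow> real" where
  "cyl_ratio n x = cyl (Suc n) x / cyl n (doubling x)"

lemma cyl_ratio_nonneg: "0 \<le> cyl_ratio n x"
  by (simp add: cyl_ratio_def cyl_nonneg)

lemma simple_function_cyl_ratio: "simple_function M (cyl_ratio n)"
  unfolding cyl_ratio_def[abs_def]
  by (rule simple_function_compose2[OF simple_function_cyl simple_function_doubling[OF simple_function_cyl]])

lemma AE_cyl_ratio_pos: "AE x in M. 0 < cyl_ratio n x"
  using AE_cyl_pos[of "Suc n"]
  by eventually_elim (use cyl_Suc_le in \<open>force simp: cyl_ratio_def intro!: divide_pos_pos intro: less_le_trans\<close>)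

lemma integrable_simple: "simple_function M f \<Longrightarrow> integrable M (\<lambda>x. g (f x) :: real)"
  by (rule integral_simple_function_real(2))

lemma fent_increment: "fent M (itin digit (Suc n)) - fent M (itin digit n) = (\<integral>x. - ln (cyl_ratio n x) \<partial>M)"
proof -
  note i = integrable_simple[OF simple_function_cyl, of "\<lambda>t. - ln t"]
    integrable_simple[OF simple_function_doubling[OF simple_function_cyl], of "\<lambda>t. - ln t"]
  have "fent M (itin digit (Suc n)) - fent M (itin digit n) = (\<integral>x. - ln (cyl (Suc n) x) - - ln (cyl n (doubling x)) \<partial>M)"
    \<comment> \<open>By invariance the entropy for n digits may be evaluated at
      \<open>doubling x\<close>, which puts both terms under one logarithm.\<close>
    unfolding fent_itin_eq_integral[of "Suc n"] fent_itin_eq_integral'[of n]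
    by (rule Bochner_Integration.integral_diff[symmetric]) (fact i)+
  also have "\<dots> = (\<integral>x. - ln (cyl_ratio n x) \<partial>M)"
  proof (rule integral_cong_AE)
    show "AE x in M. - ln (cyl (Suc n) x) - - ln (cyl n (doubling x)) = - ln (cyl_ratio n x)"
      using AE_cyl_pos[of "Suc n"]
    proof eventually_elim
      case (elim x)
      then have "0 < cyl n (doubling x)" using cyl_Suc_le less_le_trans by blast
      then show ?case using elim by (simp add: cyl_ratio_def ln_div)
    qed
    show "(\<lambda>x. - ln (cyl_ratio n x)) \<in> borel_measurable M"
      using integrable_simple[OF simple_function_cyl_ratio, of "\<lambda>t. - ln t"] by (rule borel_measurable_integrable)
    show "(\<lambda>x. - ln (cyl (Suc n) x) - - ln (cyl n (doubling x))) \<in> borel_measurable M"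
      by (intro borel_measurable_diff borel_measurable_integrable i)
  qed
  finally show ?thesis .
qed

text \<open>The preimage of the rank n cylinder of z splits by first digit into two cylinders of
  rank n + 1. Equality can fail only if that cylinder of z is null, where both ratios are 0.\<close>

lemma cyl_ratio_sum:
  assumes z: "z \<in> S1"
  shows "cyl_ratio n (z / 2) + cyl_ratio n ((z + 1) / 2) \<le> 1"
proof -
  let ?E = "\<lambda>b. {y\<in>S1. itin digit (Suc n) y = b # itin digit n z}"
  have ev: "?E b \<in> events" for b by (rule simple_function_events[OF simple_function_itin_digit])
  have "prob (?E False) + prob (?E True) = prob (?E False \<union> ?E True)"
    using ev by (intro finite_measure_Union[symmetric]) auto
  also have "?E False \<union> ?E True = {y\<in>S1. itin digit n (doubling y) = itin digit n (doubling (z / 2))}"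
    using z by (auto simp: itin_Suc)
  also have "prob \<dots> = cyl n z" unfolding cyl_doubling[symmetric] using z by simp
  finally have "cyl (Suc n) (z / 2) + cyl (Suc n) ((z + 1) / 2) = cyl n z"
    using z by (simp add: cyl_def itin_Suc)
  then show ?thesis using z by (simp add: cyl_ratio_def add_divide_distrib[symmetric])
qed

lemma ks_entropy_ge:
  assumes "\<And>n. c \<le> fent M (itin digit (Suc n)) - fent M (itin digit n)"
  shows "c \<le> ks_entropy M"
proof -
  have "real n * c \<le> fent M (itin digit n)" for n
  proof (induction n)
    case (Suc n)
    then show ?case using assms[of n] by (simp add: algebra_simps)
  qed (simp add: fent_const)
  from this[of "Suc _"] have "c \<le> fent M (itin digit (Suc n)) / real (Suc n)" for n
    by (simp add: field_simps)
  then show ?thesis by (intro LIMSEQ_le_const[OF ks_entropy_LIMSEQ]) auto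
qed

lemma ks_entropy_le:
  assumes "\<And>n. N \<le> n \<Longrightarrow> fent M (itin digit (Suc n)) - fent M (itin digit n) \<le> c"
  shows "ks_entropy M \<le> c"
proof -
  \<comment> \<open>B absorbs the first N increments, which are not controlled; it disappears after
    division by the length.\<close>
  define B where "B = fent M (itin digit N) - N * c"
  have *: "fent M (itin digit n) \<le> B + real n * c" if "N \<le> n" for n
    using that
  proof (induction n rule: dec_induct)
    case (step n)
    then show ?case using assms[of n] by (simp add: algebra_simps)
  qed (simp add: B_def)
  have le: "fent M (itin digit (Suc n)) / real (Suc n) \<le> B * inverse (real (Suc n)) + c" if "N \<le> n" for n
  proof -
    have "fent M (itin digit (Suc n)) / real (Suc n) \<le> (B + real (Suc n) * c) / real (Suc n)"
      using *[of "Suc n"] that by (intro divide_right_mono) auto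
    also have "\<dots> = B * inverse (real (Suc n)) + c" by (simp add: field_simps)
    finally show ?thesis .
  qed
  have "(\<lambda>n. B * inverse (real (Suc n)) + c) \<longlonglongrightarrow> B * 0 + c"
    by (intro tendsto_intros LIMSEQ_inverse_real_of_nat)
  from LIMSEQ_le[OF ks_entropy_LIMSEQ this] le show ?thesis by auto
qed

end

section \<open>The two inequalities of Rokhlin's formula\<close>

context jacobian begin

text \<open>Each entropy increment is the cross entropy of the competitor
  \<open>cyl_ratio n\<close>, hence at least that of J itself.\<close>

lemma integral_le_ks_entropy: "(\<integral>x. - ln (J x) \<partial>M) \<le> ks_entropy M"
proof (rule ks_entropy_ge)
  fix n
  have "cyl_ratio n \<in> borel_measurable M"
    using borel_measurable_simple_function[OF simple_function_cyl_ratio] .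
  then show "(\<integral>x. - ln (J x) \<partial>M) \<le> fent M (itin digit (Suc n)) - fent M (itin digit n)"
    unfolding fent_increment
    by (intro cross_entropy_ge AE_cyl_ratio_pos cyl_ratio_sum
        integrable_simple[OF simple_function_cyl_ratio, of ln] cyl_ratio_nonneg)
       (simp add: measurable_M_eq)
qed

text \<open>By \<open>J_int\<close> the cylinder of x has measure equal to the integral, over the
  cylinder of its image, of J on the branch with the digit of x; there J is at least
  \<open>J x - e\<close>. If this number is negative, \<open>ennreal\<close> truncates it to 0 and
  the bound is trivial.\<close>

lemma cyl_Suc_ge:
  assumes x: "x \<in> S1" and osc: "\<And>y. y \<in> S1 \<Longrightarrow> itin digit (Suc n) y = itin digit (Suc n) x \<Longrightarrow> J x - e \<le> J y"
  shows "(J x - e) * cyl n (doubling x) \<le> cyl (Suc n) x"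
proof -
  let ?C = "{y\<in>S1. itin digit (Suc n) y = itin digit (Suc n) x}"
  let ?U = "{z\<in>S1. itin digit n z = itin digit n (doubling x)}"
  have C: "?C \<in> sets M" "?U \<in> sets M"
    by (rule simple_function_events[OF simple_function_itin_digit])+
  have C'[measurable]: "?C \<in> sets S1_borel" using C by (simp add: sets_M)
  have pt: "ennreal (J x - e) * indicator ?U z \<le>
      ennreal (J (z / 2)) * indicator ?C (z / 2) + ennreal (J ((z + 1) / 2)) * indicator ?C ((z + 1) / 2)"
    if z: "z \<in> S1" for z
  proof (cases "z \<in> ?U")
    case U: True
    show ?thesis
    proof (cases "digit x")
      case True
      then have "(z + 1) / 2 \<in> ?C" using U z by (auto simp: itin_Suc)
      moreover from this have "J x - e \<le> J ((z + 1) / 2)" by (intro osc) auto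
      ultimately show ?thesis using U by (auto intro!: add_increasing ennreal_leI)
    next
      case False
      then have "z / 2 \<in> ?C" using U z by (auto simp: itin_Suc)
      moreover from this have "J x - e \<le> J (z / 2)" by (intro osc) auto
      ultimately show ?thesis using U by (auto intro!: add_increasing2 ennreal_leI)
    qed
  qed simp
  have "ennreal ((J x - e) * cyl n (doubling x)) = (\<integral>\<^sup>+ z. ennreal (J x - e) * indicator ?U z \<partial>M)"
    using C(2) by (simp add: nn_integral_cmult_indicator emeasure_eq_measure cyl_def ennreal_mult'' del: ennreal_mult)
  also have "\<dots> \<le> (\<integral>\<^sup>+ z. ennreal (J (z / 2)) * indicator ?C (z / 2) + ennreal (J ((z + 1) / 2)) * indicator ?C ((z + 1) / 2) \<partial>M)"
    by (intro nn_integral_mono pt) simp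
  also have "\<dots> = (\<integral>\<^sup>+ z. indicator ?C z \<partial>M)"
    by (rule J_int[symmetric]) measurable
  also have "\<dots> = ennreal (cyl (Suc n) x)"
    using C(1) by (simp add: emeasure_eq_measure cyl_def)
  finally show ?thesis by (simp add: cyl_nonneg)
qed

lemma ks_entropy_le_integral:
  assumes c: "0 < c" "\<And>x. x \<in> S1 \<Longrightarrow> c \<le> J x"
    and osc: "\<And>e. 0 < e \<Longrightarrow> \<exists>r>0. \<forall>x\<in>S1. \<forall>y\<in>S1. \<bar>x - y\<bar> < r \<longrightarrow> \<bar>J x - J y\<bar> \<le> e"
  shows "ks_entropy M \<le> (\<integral>x. - ln (J x) \<partial>M)"
proof (rule field_le_epsilon)
  fix d :: real assume d: "0 < d"
  \<comment> \<open>Chosen so that \<open>J x - e\<close> is at least exp(- d) J x wherever J x >=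
    c; an additive error in J becomes the error d in its logarithm.\<close>
  define e where "e = c * (1 - exp (- d))"
  have e: "0 < e" using c d by (simp add: e_def)
  obtain r where r: "r > 0" "\<And>x y. x \<in> S1 \<Longrightarrow> y \<in> S1 \<Longrightarrow> \<bar>x - y\<bar> < r \<Longrightarrow> \<bar>J x - J y\<bar> \<le> e"
    using osc[OF e] by blast
  obtain N where N: "(1/2)^N < r" using real_arch_pow_inv[OF r(1), of "1/2"] by auto
  show "ks_entropy M \<le> (\<integral>x. - ln (J x) \<partial>M) + d"
  proof (rule ks_entropy_le)
    fix n assume n: "N \<le> n"
    have ge: "exp (- d) * J x * cyl n (doubling x) \<le> cyl (Suc n) x" if x: "x \<in> S1" for x
    proof -
      have "(J x - e) * cyl n (doubling x) \<le> cyl (Suc n) x"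
      proof (rule cyl_Suc_ge[OF x])
        fix y assume y: "y \<in> S1" "itin digit (Suc n) y = itin digit (Suc n) x"
        have "itin digit N y = itin digit N x" using n by (intro itin_eq_mono[OF y(2)]) simp
        then have "\<bar>x - y\<bar> < r" using itin_digit_close[OF x y(1), of N] N by simp
        then show "J x - e \<le> J y" using r(2)[OF x y(1)] by linarith
      qed
      moreover have "c * (1 - exp (- d)) \<le> J x * (1 - exp (- d))"
        using c(2)[OF x] d by (intro mult_right_mono) auto
      then have "exp (- d) * J x \<le> J x - e" by (simp add: e_def algebra_simps)
      then have "exp (- d) * J x * cyl n (doubling x) \<le> (J x - e) * cyl n (doubling x)"
        by (intro mult_right_mono cyl_nonneg)
      ultimately show ?thesis by linarith
    qed
    have "(\<integral>x. - ln (cyl_ratio n x) \<partial>M) \<le> (\<integral>x. - ln (J x) + d \<partial>M)"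
    proof (rule integral_mono_AE)
      show "AE x in M. - ln (cyl_ratio n x) \<le> - ln (J x) + d"
        using AE_cyl_pos[of "Suc n"] AE_space
      proof eventually_elim
        case (elim x)
        then have x: "x \<in> S1" and J: "0 < J x" using c by force+
        have p: "0 < cyl n (doubling x)" using elim cyl_Suc_le less_le_trans by blast
        then have "exp (- d) * J x \<le> cyl_ratio n x" using ge[OF x] by (simp add: cyl_ratio_def field_simps)
        then have "ln (exp (- d) * J x) \<le> ln (cyl_ratio n x)" using J by (intro ln_mono) auto
        then show ?case using J by (simp add: ln_mult)
      qed
    qed (use integrable_ln_J integrable_simple[OF simple_function_cyl_ratio, of "\<lambda>t. - ln t"] in auto)
    then show "fent M (itin digit (Suc n)) - fent M (itin digit n) \<le> (\<integral>x. - ln (J x) \<partial>M) + d"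
      using integrable_ln_J prob_space by (simp add: fent_increment)
  qed
qed

end

section \<open>Existence of Jacobians\<close>

lemma (in real_prob_space) jacobian_of_gibbs:
  assumes g: "gibbs_S1 J M" and pos: "\<And>x. x \<in> S1 \<Longrightarrow> 0 \<le> J x"
    and norm: "\<And>y. y \<in> S1 \<Longrightarrow> (\<Sum>x\<in>{x\<in>S1. doubling x = y}. J x) = 1"
    and [measurable]: "J \<in> borel_measurable S1_borel"
  shows "jacobian M J"
proof -
  have sets: "sets M = sets S1_borel" and dual: "ruelle_dual J M = M"
    using g by (auto simp: gibbs_S1_def prob_S1_def)
  have [measurable_cong]: "sets M = sets S1_borel" by (fact sets)
  have sp: "space M = S1" using sets_eq_imp_space_eq[OF sets] by simp
  have fibre: "{x\<in>S1. doubling x = y} = {y / 2, (y + 1) / 2}" if "y \<in> S1" for y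
  proof -
    have "x \<in> S1 \<and> doubling x = y \<longleftrightarrow> x = y / 2 \<or> x = (y + 1) / 2" for x
      using doubling_eq_iff[OF _ that, of x] branch_in_S1[OF that] by metis
    then show ?thesis by blast
  qed
  have fsum: "(\<Sum>x\<in>{x\<in>S1. doubling x = y}. h x) = h (y / 2) + h ((y + 1) / 2)" if "y \<in> S1" for y and h :: "real \<Rightarrow> real"
    unfolding fibre[OF that] by (simp add: field_simps)
  have sig: "sigma_sets S1 (sets S1_borel) = sets S1_borel"
    using sets.sigma_sets_eq[of S1_borel] by simp
  let ?L = "\<lambda>A. \<integral>\<^sup>+ y. ennreal (ruelle_op J (indicator A) y) \<partial>M"
  \<comment> \<open>\<open>measure_of\<close> returns the null measure if the set function is not a
    measure. Total mass 1 excludes this, so the set function defining \<open>ruelle_dual\<close> is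
    a measure and its values may be read off.\<close>
  have "emeasure (ruelle_dual J M) S1 = 1" using emeasure_space_1 sp dual by simp
  then have ms: "measure_space S1 (sets S1_borel) ?L"
    unfolding ruelle_dual_def emeasure_measure_of_conv sig by (auto split: if_splits)
  have indic: "emeasure M A = (\<integral>\<^sup>+ z. ennreal (J (z / 2)) * indicator A (z / 2) +
      ennreal (J ((z + 1) / 2)) * indicator A ((z + 1) / 2) \<partial>M)" if A: "A \<in> sets S1_borel" for A
  proof -
    have "emeasure M A = emeasure (ruelle_dual J M) A" using dual by simp
    also have "\<dots> = ?L A"
      unfolding ruelle_dual_def emeasure_measure_of_conv sig using ms A by simp
    also have "\<dots> = (\<integral>\<^sup>+ z. ennreal (J (z / 2)) * indicator A (z / 2) +
      ennreal (J ((z + 1) / 2)) * indicator A ((z + 1) / 2) \<partial>M)"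
      by (intro nn_integral_cong) (auto simp: sp ruelle_op_def fsum pos ennreal_plus indicator_def)
    finally show ?thesis .
  qed
  show ?thesis
  proof
    show "J (z / 2) + J ((z + 1) / 2) = 1" if "z \<in> S1" for z
      using norm[OF that] fsum[OF that, of J] by simp
    fix f :: "real \<Rightarrow> ennreal" assume "f \<in> borel_measurable S1_borel"
    \<comment> \<open>The identity passes from indicators to nonnegative functions by sums,
      multiples and monotone limits.\<close>
    then show "(\<integral>\<^sup>+ x. f x \<partial>M) = (\<integral>\<^sup>+ z. ennreal (J (z / 2)) * f (z / 2) + ennreal (J ((z + 1) / 2)) * f ((z + 1) / 2) \<partial>M)"
    proof (induction rule: borel_measurable_induct)
      case (cong f g)
      have "(\<integral>\<^sup>+ x. f x \<partial>M) = (\<integral>\<^sup>+ x. g x \<partial>M)" using cong(3) by (intro nn_integral_cong) (simp add: sp)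
      moreover have "(\<integral>\<^sup>+ z. ennreal (J (z / 2)) * f (z / 2) + ennreal (J ((z + 1) / 2)) * f ((z + 1) / 2) \<partial>M) =
        (\<integral>\<^sup>+ z. ennreal (J (z / 2)) * g (z / 2) + ennreal (J ((z + 1) / 2)) * g ((z + 1) / 2) \<partial>M)"
        using cong(3) by (intro nn_integral_cong) (simp add: sp)
      ultimately show ?case using cong(4) by simp
    next
      case (set A)
      then show ?case using indic by (simp add: sets)
    next
      case (mult u c)
      note [measurable] = mult(2)
      have "(\<integral>\<^sup>+ x. c * u x \<partial>M) = c * (\<integral>\<^sup>+ x. u x \<partial>M)"
        by (rule nn_integral_cmult) measurable
      also have "\<dots> = (\<integral>\<^sup>+ z. c * (ennreal (J (z / 2)) * u (z / 2) + ennreal (J ((z + 1) / 2)) * u ((z + 1) / 2)) \<partial>M)"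
        unfolding mult(4) by (rule nn_integral_cmult[symmetric]) measurable
      finally show ?case by (simp add: algebra_simps)
    next
      case (add u v)
      note [measurable] = add(1,3)
      have "(\<integral>\<^sup>+ x. v x + u x \<partial>M) = (\<integral>\<^sup>+ x. v x \<partial>M) + (\<integral>\<^sup>+ x. u x \<partial>M)"
        by (rule nn_integral_add) measurable
      also have "\<dots> = (\<integral>\<^sup>+ z. (ennreal (J (z / 2)) * v (z / 2) + ennreal (J ((z + 1) / 2)) * v ((z + 1) / 2)) +
          (ennreal (J (z / 2)) * u (z / 2) + ennreal (J ((z + 1) / 2)) * u ((z + 1) / 2)) \<partial>M)"
        unfolding add by (rule nn_integral_add[symmetric]) measurable
      finally show ?case by (simp add: algebra_simps)
    next
      case (seq U)
      note [measurable] = seq(1)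
      let ?F = "\<lambda>u z. ennreal (J (z / 2)) * u (z / 2) + ennreal (J ((z + 1) / 2)) * u ((z + 1) / 2)"
      have inc: "incseq (\<lambda>i. U i x)" for x using seq(3) by (auto simp: incseq_def le_fun_def)
      have "(\<integral>\<^sup>+ x. (SUP i. U i) x \<partial>M) = (SUP i. \<integral>\<^sup>+ x. U i x \<partial>M)"
        unfolding SUP_apply by (rule nn_integral_monotone_convergence_SUP[OF seq(3)]) measurable
      also have "\<dots> = (SUP i. \<integral>\<^sup>+ z. ?F (U i) z \<partial>M)" by (simp only: seq.IH)
      also have "\<dots> = (\<integral>\<^sup>+ z. (SUP i. ?F (U i) z) \<partial>M)"
        by (rule nn_integral_monotone_convergence_SUP[symmetric])
          (auto intro!: incseq_SucI le_funI add_mono mult_left_mono incseq_SucD[OF inc])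
      also have "\<dots> = (\<integral>\<^sup>+ z. ?F (SUP i. U i) z \<partial>M)"
      proof (rule nn_integral_cong)
        fix z
        have "(SUP i. ?F (U i) z) = (SUP i. ennreal (J (z / 2)) * U i (z / 2)) + (SUP i. ennreal (J ((z + 1) / 2)) * U i ((z + 1) / 2))"
          by (rule ennreal_SUP_add) (auto simp: incseq_def intro!: mult_left_mono incseqD[OF inc])
        then show "(SUP i. ?F (U i) z) = ?F (SUP i. U i) z"
          by (simp only: SUP_mult_left_ennreal[symmetric] SUP_apply)
      qed
      finally show ?case .
    qed
  qed (use sets pos in auto)
qed

text \<open>The part of M on each half circle, pushed forward by \<open>doubling\<close>, is
  dominated by M because M is invariant. The two Radon-Nikodym densities are the conditional
  probabilities of the digit given the image point.\<close>

lemma (in doubling_invariant) jacobian_exists: "\<exists>J. jacobian M J"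
proof -
  note [measurable_cong] = sets_M
  have [measurable]: "Measurable.pred S1_borel digit"
    unfolding digit_def[abs_def] by measurable
  have RN: "\<exists>f\<in>borel_measurable M. \<forall>F\<in>borel_measurable S1_borel.
      (\<integral>\<^sup>+ x. indicator {x. digit x = b} x * F (doubling x) \<partial>M) = (\<integral>\<^sup>+ z. f z * F z \<partial>M)" for b
  proof -
    let ?d = "density M (indicator {x. digit x = b})"
    let ?N = "distr ?d M doubling"
    have [measurable]: "(indicator {x. digit x = b} :: real \<Rightarrow> ennreal) \<in> borel_measurable M" by measurable
    have eq: "(\<integral>\<^sup>+ x. F x \<partial>?N) = (\<integral>\<^sup>+ x. indicator {x. digit x = b} x * F (doubling x) \<partial>M)"
      if [measurable]: "F \<in> borel_measurable S1_borel" for F :: "real \<Rightarrow> ennreal"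
    proof -
      have "(\<integral>\<^sup>+ x. F x \<partial>?N) = (\<integral>\<^sup>+ x. F (doubling x) \<partial>?d)"
        by (rule nn_integral_distr) measurable
      also have "\<dots> = (\<integral>\<^sup>+ x. indicator {x. digit x = b} x * F (doubling x) \<partial>M)"
        by (rule nn_integral_density) measurable
      finally show ?thesis .
    qed
    have "absolutely_continuous M ?N" unfolding absolutely_continuous_def
    proof
      fix A assume A: "A \<in> null_sets M"
      then have [measurable]: "A \<in> sets M" by auto
      have "emeasure ?N A = (\<integral>\<^sup>+ x. indicator A x \<partial>?N)" by simp
      also have "\<dots> = (\<integral>\<^sup>+ x. indicator {x. digit x = b} x * indicator A (doubling x) \<partial>M)"
        by (rule eq) measurable
      also have "\<dots> \<le> (\<integral>\<^sup>+ x. indicator A (doubling x) \<partial>M)"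
        by (intro nn_integral_mono) (auto simp: indicator_def)
      also have "\<dots> = (\<integral>\<^sup>+ x. indicator A x \<partial>distr M M doubling)"
        by (rule nn_integral_distr[symmetric]) measurable
      also have "\<dots> = 0" using A by (simp add: distr_doubling null_sets_def)
      finally show "A \<in> null_sets ?N" by (simp add: null_sets_def)
    qed
    then obtain f where f[measurable]: "f \<in> borel_measurable M" and d: "density M f = ?N"
      using Radon_Nikodym[of ?N] by auto
    have "(\<integral>\<^sup>+ x. indicator {x. digit x = b} x * F (doubling x) \<partial>M) = (\<integral>\<^sup>+ z. f z * F z \<partial>M)"
      if [measurable]: "F \<in> borel_measurable S1_borel" for F
      using eq[OF that] nn_integral_density[OF f, of F] by (simp add: d[symmetric])
    then show ?thesis using f by auto
  qed
  obtain f0 where f0[measurable]: "f0 \<in> borel_measurable M"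
    and F0: "\<And>F. F \<in> borel_measurable S1_borel \<Longrightarrow> (\<integral>\<^sup>+ x. indicator {x. digit x = False} x * F (doubling x) \<partial>M) = (\<integral>\<^sup>+ z. f0 z * F z \<partial>M)"
    using RN[of False] by auto
  obtain f1 where f1[measurable]: "f1 \<in> borel_measurable M"
    and F1: "\<And>F. F \<in> borel_measurable S1_borel \<Longrightarrow> (\<integral>\<^sup>+ x. indicator {x. digit x = True} x * F (doubling x) \<partial>M) = (\<integral>\<^sup>+ z. f1 z * F z \<partial>M)"
    using RN[of True] by auto
  have "density M (\<lambda>z. f0 z + f1 z) = density M (\<lambda>z. 1)"
  proof (rule measure_eqI)
    fix A assume "A \<in> sets (density M (\<lambda>z. f0 z + f1 z))"
    then have A[measurable]: "A \<in> sets M" by simp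
    have "emeasure (density M (\<lambda>z. f0 z + f1 z)) A = (\<integral>\<^sup>+ z. f0 z * indicator A z + f1 z * indicator A z \<partial>M)"
      by (subst emeasure_density) (auto simp: distrib_right)
    also have "\<dots> = (\<integral>\<^sup>+ z. f0 z * indicator A z \<partial>M) + (\<integral>\<^sup>+ z. f1 z * indicator A z \<partial>M)"
      by (rule nn_integral_add) measurable
    also have "\<dots> = (\<integral>\<^sup>+ x. indicator {x. digit x = False} x * indicator A (doubling x) \<partial>M) +
        (\<integral>\<^sup>+ x. indicator {x. digit x = True} x * indicator A (doubling x) \<partial>M)"
      by (subst F0 F1; measurable)+
    also have "\<dots> = (\<integral>\<^sup>+ x. indicator {x. digit x = False} x * indicator A (doubling x) +
        indicator {x. digit x = True} x * indicator A (doubling x) \<partial>M)"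
      by (rule nn_integral_add[symmetric]) measurable
    also have "\<dots> = (\<integral>\<^sup>+ x. indicator A (doubling x) \<partial>M)"
      by (intro nn_integral_cong) (auto simp: indicator_def)
    also have "\<dots> = (\<integral>\<^sup>+ x. indicator A x \<partial>distr M M doubling)"
      by (rule nn_integral_distr[symmetric]) measurable
    also have "\<dots> = emeasure (density M (\<lambda>z. 1)) A"
      using A by (simp add: distr_doubling emeasure_density)
    finally show "emeasure (density M (\<lambda>z. f0 z + f1 z)) A = emeasure (density M (\<lambda>z. 1)) A" .
  qed simp
  then have sum1: "AE z in M. f0 z + f1 z = 1"
    by (rule density_unique[rotated 2]) measurable
  \<comment> \<open>Truncating one density at 1 and using 1 - g on the other branch makes the fibre
    sums exactly 1 everywhere, at the price of a change on a null set.\<close>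
  define g where "g = (\<lambda>z. enn2real (min 1 (f0 z)))"
  have g[measurable]: "g \<in> borel_measurable S1_borel"
    unfolding g_def measurable_M_eq(1)[symmetric] by measurable
  have g01: "0 \<le> g z" "g z \<le> 1" for z
    by (auto simp: g_def intro: enn2real_leI)
  define J where "J = (\<lambda>x. if digit x then 1 - g (doubling x) else g (doubling x))"
  have fg: "AE z in M. f0 z = ennreal (g z) \<and> f1 z = ennreal (1 - g z)"
    using sum1
  proof eventually_elim
    case (elim z)
    have f0: "f0 z \<le> 1" using elim by (metis le_iff_add)
    then have top: "f0 z < \<top>" by (simp add: le_less_trans ennreal_one_less_top)
    have 1: "f0 z = ennreal (g z)" using f0 top by (simp add: g_def min_absorb2)
    have "f1 z = 1 - f0 z" using elim top by (metis add.commute ennreal_add_diff_cancel_right less_irrefl)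
    also have "\<dots> = ennreal (1 - g z)" unfolding 1 by (simp add: ennreal_minus g01 flip: ennreal_1)
    finally show ?case using 1 by simp
  qed
  have "jacobian M J"
  proof
    show "J \<in> borel_measurable S1_borel" unfolding J_def by measurable
    show "J (z / 2) + J ((z + 1) / 2) = 1" if "z \<in> S1" for z using that by (simp add: J_def)
    show "0 \<le> J x" if "x \<in> S1" for x using g01 by (simp add: J_def)
    fix f :: "real \<Rightarrow> ennreal" assume [measurable]: "f \<in> borel_measurable S1_borel"
    have "(\<integral>\<^sup>+ x. f x \<partial>M) = (\<integral>\<^sup>+ x. indicator {x. digit x = False} x * f (doubling x / 2) +
        indicator {x. digit x = True} x * f ((doubling x + 1) / 2) \<partial>M)"
    proof (rule nn_integral_cong)
      fix x assume "x \<in> space M"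
      then have "x \<in> S1" by simp
      from arg_cong[OF branch_doubling[OF this], of f]
      show "f x = indicator {x. digit x = False} x * f (doubling x / 2) + indicator {x. digit x = True} x * f ((doubling x + 1) / 2)"
        by (cases "digit x") auto
    qed
    also have "\<dots> = (\<integral>\<^sup>+ x. indicator {x. digit x = False} x * f (doubling x / 2) \<partial>M) +
        (\<integral>\<^sup>+ x. indicator {x. digit x = True} x * f ((doubling x + 1) / 2) \<partial>M)"
      by (rule nn_integral_add) measurable
    also have "\<dots> = (\<integral>\<^sup>+ z. f0 z * f (z / 2) \<partial>M) + (\<integral>\<^sup>+ z. f1 z * f ((z + 1) / 2) \<partial>M)"
      by (subst F0[of "\<lambda>z. f (z / 2)"] F1[of "\<lambda>z. f ((z + 1) / 2)"]; measurable)+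
    also have "\<dots> = (\<integral>\<^sup>+ z. f0 z * f (z / 2) + f1 z * f ((z + 1) / 2) \<partial>M)"
      by (rule nn_integral_add[symmetric]) measurable
    also have "\<dots> = (\<integral>\<^sup>+ z. ennreal (J (z / 2)) * f (z / 2) + ennreal (J ((z + 1) / 2)) * f ((z + 1) / 2) \<partial>M)"
      using fg AE_space by (intro nn_integral_cong_AE, eventually_elim) (simp add: J_def)
    finally show "(\<integral>\<^sup>+ x. f x \<partial>M) = \<dots>" .
  qed (fact sets_M)
  then show ?thesis by blast
qed

section \<open>Almost sure properties along full orbits\<close>

context jacobian begin

text \<open>The indicator of a null set N has integral 0, and in \<open>J_int\<close> it is weighted
  by positive numbers, so for almost every z neither preimage lies in N.\<close>

lemma AE_branches:
  assumes pos: "\<And>x. x \<in> S1 \<Longrightarrow> 0 < J x" and P: "AE x in M. P x"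
  shows "AE z in M. \<forall>x\<in>S1. doubling x = z \<longrightarrow> P x"
proof -
  note [measurable_cong] = sets_M
  obtain N where N: "{x\<in>space M. \<not> P x} \<subseteq> N" "N \<in> null_sets M"
    using P unfolding eventually_ae_filter by blast
  have [measurable]: "N \<in> sets S1_borel" using N(2) sets_M by (auto simp: null_sets_def)
  let ?F = "\<lambda>z. ennreal (J (z / 2)) * indicator N (z / 2) + ennreal (J ((z + 1) / 2)) * indicator N ((z + 1) / 2)"
  have "(\<integral>\<^sup>+ z. ?F z \<partial>M) = (\<integral>\<^sup>+ x. indicator N x \<partial>M)"
    by (rule J_int[symmetric]) measurable
  also have "\<dots> = 0" using N(2) by (simp add: null_sets_def)
  finally have "AE z in M. ?F z = 0" by (subst (asm) nn_integral_0_iff_AE) auto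
  then show ?thesis using AE_space
  proof eventually_elim
    case (elim z)
    then have z: "z \<in> S1" by simp
    then have "z / 2 \<notin> N" "(z + 1) / 2 \<notin> N" using elim pos[of "z / 2"] pos[of "(z + 1) / 2"]
      by (auto simp: indicator_def split: if_splits)
    then have "x \<notin> N" if "x \<in> S1" "doubling x = z" for x
      using doubling_eq_iff[OF that(1) z] that(2) by metis
    then show ?case using N(1) by auto
  qed
qed

text \<open>Points with the same n-th image are exactly the rotations of one another by multiples of
  1 / 2^n, so this is quasi-invariance under dyadic rotations.\<close>

lemma AE_grand_orbit:
  assumes pos: "\<And>x. x \<in> S1 \<Longrightarrow> 0 < J x" and P: "AE x in M. P x"
  shows "AE x in M. \<forall>n. \<forall>y\<in>S1. (doubling ^^ n) y = (doubling ^^ n) x \<longrightarrow> P y"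
proof -
  have "AE x in M. \<forall>y\<in>S1. (doubling ^^ n) y = (doubling ^^ n) x \<longrightarrow> P y" for n
    using P
  proof (induction n arbitrary: P)
    case 0
    then show ?case by eventually_elim auto
  next
    case (Suc n)
    \<comment> \<open>The induction hypothesis is used for the property that P holds at all
      preimages, and the result is then evaluated at \<open>doubling x\<close> by
      invariance.\<close>
    have "AE x in distr M M doubling. \<forall>y\<in>S1. (doubling ^^ n) y = (doubling ^^ n) x \<longrightarrow> (\<forall>x\<in>S1. doubling x = y \<longrightarrow> P x)"
      unfolding distr_doubling by (rule Suc.IH[OF AE_branches[OF pos Suc.prems]])
    from AE_distrD[OF measurable_doubling_M this] show ?case
      by eventually_elim (auto simp: funpow_swap1)
  qed
  then show ?thesis by (simp add: AE_all_countable)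
qed

end

section \<open>Hoelder functions, dyadic rotations and Lebesgue measure\<close>

text \<open>\<open>S1\<close> is not compact; composing with \<open>frac\<close> moves J to the
  closed interval, where 1 is identified with 0 and \<open>circ_dist\<close> is at most the ordinary
  distance.\<close>

lemma holder_frac_bound:
  assumes "holder_S1 J"
  obtains C \<alpha> where "0 \<le> C" "0 < \<alpha>"
    "\<And>s t. s \<in> {0..1} \<Longrightarrow> t \<in> {0..1} \<Longrightarrow> \<bar>J (frac s) - J (frac t)\<bar> \<le> C * \<bar>s - t\<bar> powr \<alpha>"
proof -
  obtain C \<alpha> where \<alpha>: "0 < \<alpha>" and C: "\<forall>x\<in>S1. \<forall>y\<in>S1. \<bar>J x - J y\<bar> \<le> C * circ_dist x y powr \<alpha>"
    using assms unfolding holder_S1_def by blast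
  have "\<bar>J (frac s) - J (frac t)\<bar> \<le> \<bar>C\<bar> * \<bar>s - t\<bar> powr \<alpha>" if st: "s \<in> {0..1}" "t \<in> {0..1}" for s t
  proof -
    have fr: "frac u = (if u = 1 then 0 else u)" if "u \<in> {0..1}" for u :: real
      using that by (auto simp: frac_eq frac_of_int[of 1, simplified])
    have d: "0 \<le> circ_dist (frac s) (frac t)" "circ_dist (frac s) (frac t) \<le> \<bar>s - t\<bar>"
      using st by (auto simp: fr circ_dist_def)
    have "\<bar>J (frac s) - J (frac t)\<bar> \<le> C * circ_dist (frac s) (frac t) powr \<alpha>" using C by simp
    also have "\<dots> \<le> \<bar>C\<bar> * \<bar>s - t\<bar> powr \<alpha>"
      using d \<alpha> by (intro mult_mono powr_mono2) auto
    finally show ?thesis .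
  qed
  then show ?thesis using that[of "\<bar>C\<bar>" \<alpha>] \<alpha> by simp
qed

lemma holder_S1_uniformly_continuous:
  assumes "holder_S1 J" "0 < e"
  shows "\<exists>r>0. \<forall>s\<in>{0..1}. \<forall>t\<in>{0..1}. \<bar>s - t\<bar> < r \<longrightarrow> \<bar>J (frac s) - J (frac t)\<bar> \<le> e"
proof -
  obtain C \<alpha> where C: "0 \<le> C" "0 < \<alpha>"
    "\<And>s t. s \<in> {0..1} \<Longrightarrow> t \<in> {0..1} \<Longrightarrow> \<bar>J (frac s) - J (frac t)\<bar> \<le> C * \<bar>s - t\<bar> powr \<alpha>"
    using holder_frac_bound[OF assms(1)] by blast
  \<comment> \<open>Solves (C + 1) r^\<alpha> = e; adding 1 to C avoids division by 0.\<close>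
  define r where "r = (e / (C + 1)) powr (1 / \<alpha>)"
  have ra: "r powr \<alpha> = e / (C + 1)" using C assms(2) by (simp add: r_def powr_powr)
  have "\<bar>J (frac s) - J (frac t)\<bar> \<le> e" if "s \<in> {0..1}" "t \<in> {0..1}" "\<bar>s - t\<bar> < r" for s t
  proof -
    have "\<bar>J (frac s) - J (frac t)\<bar> \<le> C * \<bar>s - t\<bar> powr \<alpha>" using C that by simp
    also have "\<dots> \<le> C * r powr \<alpha>" using that C by (intro mult_left_mono powr_mono2) auto
    also have "\<dots> \<le> e" unfolding ra using C assms(2) by (simp add: field_simps)
    finally show ?thesis .
  qed
  moreover have "r > 0" using C assms(2) by (simp add: r_def)
  ultimately show ?thesis by blast
qed

lemma holder_S1_uniform:
  assumes "holder_S1 J" "0 < e"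
  shows "\<exists>r>0. \<forall>x\<in>S1. \<forall>y\<in>S1. \<bar>x - y\<bar> < r \<longrightarrow> \<bar>J x - J y\<bar> \<le> e"
proof -
  obtain r where r: "r > 0" "\<And>s t. s\<in>{0..1} \<Longrightarrow> t\<in>{0..1} \<Longrightarrow> \<bar>s - t\<bar> < r \<Longrightarrow> \<bar>J (frac s) - J (frac t)\<bar> \<le> e"
    using holder_S1_uniformly_continuous[OF assms] by blast
  have "\<bar>J x - J y\<bar> \<le> e" if "x \<in> S1" "y \<in> S1" "\<bar>x - y\<bar> < r" for x y
    using r(2)[of x y] that by (simp add: S1_def frac_eq_id)
  then show ?thesis using r(1) by blast
qed

lemma holder_S1_measurable:
  assumes "holder_S1 J"
  shows "J \<in> borel_measurable S1_borel"
  unfolding S1_borel_def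
proof (rule borel_measurable_continuous_on_restrict)
  show "continuous_on S1 J" unfolding continuous_on_iff
  proof (intro ballI allI impI)
    fix x e :: real assume x: "x \<in> S1" and e: "0 < e"
    obtain r where r: "r > 0" "\<And>x y. x\<in>S1 \<Longrightarrow> y\<in>S1 \<Longrightarrow> \<bar>x - y\<bar> < r \<Longrightarrow> \<bar>J x - J y\<bar> \<le> e / 2"
      using holder_S1_uniform[OF assms, of "e/2"] e by auto
    have "dist (J y) (J x) < e" if "y \<in> S1" "dist y x < r" for y
      using r(2)[OF that(1) x] that(2) e by (simp add: dist_real_def)
    then show "\<exists>d>0. \<forall>y\<in>S1. dist y x < d \<longrightarrow> dist (J y) (J x) < e" using r(1) by blast
  qed
qed

text \<open>The minimum is attained on the compact interval [0, 1] by the periodic continuation of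
  J.\<close>

lemma holder_S1_lower_bound:
  assumes "holder_S1 J" and pos: "\<And>x. x \<in> S1 \<Longrightarrow> 0 < J x"
  obtains c where "0 < c" "\<And>x. x \<in> S1 \<Longrightarrow> c \<le> J x"
proof -
  have cont: "continuous_on {0..1} (\<lambda>t. J (frac t))" unfolding continuous_on_iff
  proof (intro ballI allI impI)
    fix x e :: real assume x: "x \<in> {0..1}" and e: "0 < e"
    obtain r where r: "r > 0" "\<And>x y. x\<in>{0..1} \<Longrightarrow> y\<in>{0..1} \<Longrightarrow> \<bar>x - y\<bar> < r \<Longrightarrow> \<bar>J (frac x) - J (frac y)\<bar> \<le> e / 2"
      using holder_S1_uniformly_continuous[OF assms(1), of "e/2"] e by auto
    have "dist (J (frac y)) (J (frac x)) < e" if "y \<in> {0..1}" "dist y x < r" for y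
      using r(2)[OF that(1) x] that(2) e by (simp add: dist_real_def)
    then show "\<exists>d>0. \<forall>y\<in>{0..1}. dist y x < d \<longrightarrow> dist (J (frac y)) (J (frac x)) < e" using r(1) by blast
  qed
  obtain s where s: "s \<in> {0..1}" "\<And>t. t \<in> {0..1} \<Longrightarrow> J (frac s) \<le> J (frac t)"
    using continuous_attains_inf[OF _ _ cont] by auto
  show ?thesis
  proof (rule that[of "J (frac s)"])
    show "0 < J (frac s)" by (rule pos) simp
    show "J (frac s) \<le> J x" if "x \<in> S1" for x
      using s(2)[of x] that by (simp add: S1_def frac_eq_id)
  qed
qed

section \<open>Dyadic rotations\<close>

lemma doubling_frac: "doubling (frac x) = frac (2 * x)"
proof -
  have "2 * frac x = 2 * x + of_int (- 2 * \<lfloor>x\<rfloor>)" by (simp add: frac_def algebra_simps)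
  then show ?thesis unfolding doubling_def by (simp only: frac_add_of_int_right)
qed

lemma funpow_doubling_frac: "(doubling ^^ n) (frac x) = frac (2 ^ n * x)"
  by (induction n) (auto simp: doubling_frac mult.assoc)

lemma doubling_frac_add: "doubling (frac (x + y)) = frac (doubling x + doubling y)"
  by (simp add: doubling_frac) (simp add: doubling_def algebra_simps)

lemma dyadic_shift:
  assumes "x \<in> S1"
  shows "(doubling ^^ n) (frac (x + of_int k / 2 ^ n)) = (doubling ^^ n) x"
proof -
  have "(doubling ^^ n) (frac (x + of_int k / 2 ^ n)) = frac (2 ^ n * x + of_int k)"
    unfolding funpow_doubling_frac by (simp add: distrib_left)
  also have "\<dots> = (doubling ^^ n) (frac x)" by (simp add: funpow_doubling_frac)
  finally show ?thesis using assms by simp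
qed

lemma dyadic_shift_dense:
  assumes "y \<in> S1" "t \<in> S1" "0 < r"
  obtains n k where "\<bar>frac (y + of_int k / 2 ^ n) - t\<bar> < r"
proof -
  \<comment> \<open>Rounding up gives u >= t, and the bound 1 - t keeps u below 1, so that
    \<open>frac u\<close> is u itself.\<close>
  have "0 < min r (1 - t)" using assms by (auto simp: S1_def)
  then obtain n where n: "(1/2)^n < min r (1 - t)"
    using real_arch_pow_inv[of "min r (1 - t)" "1/2"] by auto
  define k where "k = \<lceil>(t - y) * 2 ^ n\<rceil>"
  define u where "u = y + of_int k / 2 ^ n"
  have "of_int k - 1 < (t - y) * 2 ^ n" "(t - y) * 2 ^ n \<le> of_int k"
    unfolding k_def by linarith+
  then have "0 \<le> (of_int k - (t - y) * 2 ^ n) / 2 ^ n" "(of_int k - (t - y) * 2 ^ n) / 2 ^ n < 1 / 2 ^ n"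
    by (auto intro: divide_strict_right_mono)
  moreover have "u - t = (of_int k - (t - y) * 2 ^ n) / 2 ^ n"
    by (simp add: u_def field_simps)
  ultimately have "t \<le> u" "u < t + (1/2)^n" by (simp_all add: power_one_over)
  then have "\<bar>u - t\<bar> < r" "u \<in> S1" using n assms(2) by (auto simp: S1_def)
  then show ?thesis using that[of k n] by (simp add: u_def[symmetric])
qed

text \<open>A form of the normalisation that commutes with translations: w and w + 1/2 make up one
  fibre of \<open>doubling\<close>.\<close>

lemma (in jacobian) J_add_half:
  assumes "w \<in> S1"
  shows "J w + J (frac (w + 1 / 2)) = 1"
proof (cases "digit w")
  case True
  have "frac (w + 1 / 2) = w - 1 / 2"
    unfolding frac_unique_iff using True assms by (auto simp: digit_def S1_def)
  then have "frac (w + 1 / 2) = doubling w / 2" "w = (doubling w + 1) / 2"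
    using True assms by (auto simp: doubling_digit)
  then show ?thesis using J_sum[OF doubling_in_S1, of w] by (metis add.commute)
next
  case False
  then have "frac (w + 1 / 2) = (doubling w + 1) / 2" "w = doubling w / 2"
    using assms by (auto simp: doubling_digit digit_def S1_def frac_eq)
  then show ?thesis using J_sum[OF doubling_in_S1, of w] by metis
qed

section \<open>Lebesgue measure as the only measure with Jacobian 1/2\<close>

lemma jacobian_lebesgue: "jacobian lebesgue_S1 (\<lambda>_. 1 / 2)"
proof -
  have sets: "sets lebesgue_S1 = sets S1_borel"
    by (simp add: lebesgue_S1_def S1_borel_def sets_restrict_space)
  have S: "S1 \<inter> space lborel \<in> sets lborel" by simp
  interpret real_prob_space lebesgue_S1
    by (intro real_prob_space.intro prob_spaceI)
       (simp add: lebesgue_S1_def emeasure_restrict_space space_restrict_space, simp add: S1_def)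
  show ?thesis
  proof
    fix f :: "real \<Rightarrow> ennreal" assume f: "f \<in> borel_measurable S1_borel"
    define F where "F x = f x * indicator S1 x" for x
    have F[measurable]: "F \<in> borel_measurable borel"
      using f unfolding F_def S1_borel_def by (subst (asm) borel_measurable_restrict_space_iff_ennreal) auto
    have Fb: "(\<lambda>z. F ((z + a) / 2)) \<in> borel_measurable borel" for a
      by (rule measurable_compose[OF _ F]) (intro borel_measurable_divide borel_measurable_add; simp)
    have int: "(\<integral>\<^sup>+ x. g x \<partial>lebesgue_S1) = (\<integral>\<^sup>+ x. g x * indicator S1 x \<partial>lborel)" for g :: "real \<Rightarrow> ennreal"
      unfolding lebesgue_S1_def by (rule nn_integral_restrict_space[OF S])
    \<comment> \<open>The substitution x = (z + a) / 2; a = 0 and a = 1 give the two inverse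
      branches.\<close>
    have h: "(\<integral>\<^sup>+ x. F x * indicator {a / 2..<(a + 1) / 2} x \<partial>lborel) =
        (\<integral>\<^sup>+ z. ennreal (1 / 2) * F ((z + a) / 2) * indicator S1 z \<partial>lborel)" for a
    proof -
      have "(\<integral>\<^sup>+ x. F x * indicator {a / 2..<(a + 1) / 2} x \<partial>lborel) =
        ennreal \<bar>1 / 2\<bar> * (\<integral>\<^sup>+ z. F (a / 2 + 1 / 2 * z) * indicator {a / 2..<(a + 1) / 2} (a / 2 + 1 / 2 * z) \<partial>lborel)"
        by (rule nn_integral_real_affine) auto
      also have "\<dots> = (\<integral>\<^sup>+ z. ennreal (1 / 2) * (F (a / 2 + 1 / 2 * z) * indicator {a / 2..<(a + 1) / 2} (a / 2 + 1 / 2 * z)) \<partial>lborel)"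
        by (subst nn_integral_cmult) auto
      also have "\<dots> = (\<integral>\<^sup>+ z. ennreal (1 / 2) * F ((z + a) / 2) * indicator S1 z \<partial>lborel)"
      proof (rule nn_integral_cong)
        fix z
        have "a / 2 + 1 / 2 * z = (z + a) / 2" by (simp add: field_simps)
        moreover have "indicator {a / 2..<(a + 1) / 2} ((z + a) / 2) = (indicator S1 z :: ennreal)"
          by (auto simp: indicator_def S1_def field_simps)
        ultimately show "ennreal (1 / 2) * (F (a / 2 + 1 / 2 * z) * indicator {a / 2..<(a + 1) / 2} (a / 2 + 1 / 2 * z)) =
            ennreal (1 / 2) * F ((z + a) / 2) * indicator S1 z"
          by (simp only: mult.assoc)
      qed
      finally show ?thesis .
    qed
    have "(\<integral>\<^sup>+ x. f x \<partial>lebesgue_S1) =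
        (\<integral>\<^sup>+ x. F x * indicator {0 / 2..<(0 + 1) / 2} x + F x * indicator {1 / 2..<(1 + 1) / 2} x \<partial>lborel)"
      unfolding int by (intro nn_integral_cong) (auto simp: F_def indicator_def S1_def)
    also have "\<dots> = (\<integral>\<^sup>+ x. F x * indicator {0 / 2..<(0 + 1) / 2} x \<partial>lborel) + (\<integral>\<^sup>+ x. F x * indicator {1 / 2..<(1 + 1) / 2} x \<partial>lborel)"
      by (rule nn_integral_add; intro borel_measurable_times_ennreal; simp)
    also have "\<dots> = (\<integral>\<^sup>+ z. ennreal (1 / 2) * F ((z + 0) / 2) * indicator S1 z + ennreal (1 / 2) * F ((z + 1) / 2) * indicator S1 z \<partial>lborel)"
      unfolding h by (rule nn_integral_add[symmetric]; intro borel_measurable_times_ennreal; simp add: Fb)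
    also have "\<dots> = (\<integral>\<^sup>+ z. (ennreal (1 / 2) * f (z / 2) + ennreal (1 / 2) * f ((z + 1) / 2)) \<partial>lebesgue_S1)"
      unfolding int by (intro nn_integral_cong) (auto simp: F_def distrib_right indicator_def S1_def)
    finally show "(\<integral>\<^sup>+ x. f x \<partial>lebesgue_S1) = \<dots>" .
  qed (use sets in auto)
qed

lemma (in jacobian) prob_cyl_half:
  assumes half: "\<And>x. x \<in> S1 \<Longrightarrow> J x = 1 / 2"
  shows "prob {x\<in>S1. itin digit n x = w} = (if length w = n then (1 / 2) ^ n else 0)"
proof (induction n arbitrary: w)
  case 0
  then show ?case using prob_space by (cases w) auto
next
  case (Suc n)
  show ?case
  proof (cases w)
    case Nil
    then show ?thesis by (simp add: itin_Suc)
  next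
    case (Cons b u)
    let ?C = "{x\<in>S1. itin digit (Suc n) x = w}" and ?U = "{x\<in>S1. itin digit n x = u}"
    have C: "?C \<in> sets M" "?U \<in> sets M"
      by (rule simple_function_events[OF simple_function_itin_digit])+
    have [measurable]: "?C \<in> sets S1_borel" using C by (simp add: sets_M)
    have "emeasure M ?C = (\<integral>\<^sup>+ x. indicator ?C x \<partial>M)" using C by simp
    also have "\<dots> = (\<integral>\<^sup>+ z. ennreal (J (z / 2)) * indicator ?C (z / 2) + ennreal (J ((z + 1) / 2)) * indicator ?C ((z + 1) / 2) \<partial>M)"
      by (rule J_int) measurable
    also have "\<dots> = (\<integral>\<^sup>+ z. ennreal (1 / 2) * indicator ?U z \<partial>M)"
      by (intro nn_integral_cong) (auto simp: half indicator_def itin_Suc Cons)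
    also have "\<dots> = ennreal (1 / 2) * emeasure M ?U"
      using C by (simp add: nn_integral_cmult_indicator)
    also have "\<dots> = ennreal (1 / 2 * prob ?U)"
      unfolding emeasure_eq_measure by (rule ennreal_mult'[symmetric]) simp
    finally have "prob ?C = 1 / 2 * prob ?U"
      unfolding emeasure_eq_measure by (subst (asm) ennreal_inj) auto
    then show ?thesis using Suc.IH[of u] by (cases "length u = n") (auto simp: Cons)
  qed
qed

text \<open>The two measures agree on dyadic cells, hence on open sets as limits of inner cells,
  hence on all Borel sets since open sets form a generator stable under intersection.\<close>

lemma jacobian_half_unique:
  assumes "jacobian M J" "jacobian N K"
    and J: "\<And>x. x \<in> S1 \<Longrightarrow> J x = 1 / 2" and K: "\<And>x. x \<in> S1 \<Longrightarrow> K x = 1 / 2"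
  shows "M = N"
proof -
  interpret M: jacobian M J by fact
  interpret N: jacobian N K by fact
  have eq: "M.prob {x\<in>S1. itin digit n x \<in> W} = N.prob {x\<in>S1. itin digit n x \<in> W}" for n W
  proof -
    have fin: "finite (itin digit n ` S1)"
      using simple_functionD(1)[OF M.simple_function_itin_digit] by simp
    have *: "{y\<in>S1. itin digit n y \<in> W \<and> itin digit n y = k} =
        (if k \<in> W then {x\<in>S1. itin digit n x = k} else {})" for k by auto
    have "M.prob {x\<in>S1. itin digit n x \<in> W} =
        (\<Sum>k\<in>itin digit n ` S1. M.prob (if k \<in> W then {x\<in>S1. itin digit n x = k} else {}))"
      using M.prob_eq_sum_fibres[OF M.simple_function_itin_digit[of n] fin _
          M.simple_function_events[OF M.simple_function_itin_digit[of n], where Q="\<lambda>v. v \<in> W"]]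
      by (simp add: *)
    also have "\<dots> = (\<Sum>k\<in>itin digit n ` S1. N.prob (if k \<in> W then {x\<in>S1. itin digit n x = k} else {}))"
      by (intro sum.cong refl) (simp add: M.prob_cyl_half[OF J] N.prob_cyl_half[OF K])
    also have "\<dots> = N.prob {x\<in>S1. itin digit n x \<in> W}"
      using N.prob_eq_sum_fibres[OF N.simple_function_itin_digit[of n] fin _
          N.simple_function_events[OF N.simple_function_itin_digit[of n], where Q="\<lambda>v. v \<in> W"]]
      by (simp add: *)
    finally show ?thesis .
  qed
  have eqU: "M.prob (U \<inter> S1) = N.prob (U \<inter> S1)" if "open U" for U
    using M.prob_inner_cells_LIMSEQ[OF that] N.prob_inner_cells_LIMSEQ[OF that]
    unfolding eq by (rule LIMSEQ_unique)
  note [measurable_cong] = M.sets_M N.sets_M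
  have [measurable]: "(\<lambda>x. x) \<in> borel_measurable M" "(\<lambda>x. x) \<in> borel_measurable N" by measurable
  let ?M = "distr M borel (\<lambda>x. x)" and ?N = "distr N borel (\<lambda>x. x)"
  have MN: "?M = ?N"
  proof (rule measure_eqI_generator_eq[where E="{S. open S}" and \<Omega>=UNIV and A="\<lambda>_. UNIV"])
    show "Int_stable {S::real set. open S}" by (auto simp: Int_stable_def)
    show "sets ?M = sigma_sets UNIV {S. open S}" "sets ?N = sigma_sets UNIV {S. open S}"
      by (simp_all add: borel_def)
    show "emeasure ?M X = emeasure ?N X" if "X \<in> {S. open S}" for X
      using that by (simp add: emeasure_distr M.emeasure_eq_measure N.emeasure_eq_measure eqU)
    show "emeasure ?M UNIV \<noteq> \<infinity>"
      by (simp add: emeasure_distr M.emeasure_eq_measure)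
  qed auto
  show ?thesis
  proof (rule measure_eqI)
    show "sets M = sets N" by (simp add: M.sets_M N.sets_M)
    fix A assume "A \<in> sets M"
    then have A: "A \<subseteq> S1" "A \<in> sets borel" by (auto simp: M.sets_M sets_S1_borel_iff)
    have "emeasure M A = emeasure ?M A" using A by (simp add: emeasure_distr Int_absorb2)
    also have "\<dots> = emeasure N A" unfolding MN using A by (simp add: emeasure_distr Int_absorb2)
    finally show "emeasure M A = emeasure N A" .
  qed
qed

section \<open>Convolution\<close>

lemma measurable_add_S1:
  assumes "sets M = sets S1_borel" "sets N = sets S1_borel"
  shows "(\<lambda>(x, y). frac (x + y)) \<in> measurable (M \<Otimes>\<^sub>M N) S1_borel"
proof -
  have "sets (M \<Otimes>\<^sub>M N) = sets (S1_borel \<Otimes>\<^sub>M S1_borel)" using assms by (rule sets_pair_measure_cong)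
  moreover have "(\<lambda>p. fst p + snd p) \<in> borel_measurable (S1_borel \<Otimes>\<^sub>M S1_borel)"
    by (intro borel_measurable_add measurable_compose[OF measurable_fst measurable_S1_id]
        measurable_compose[OF measurable_snd measurable_S1_id])
  from measurable_compose[OF this measurable_frac_S1]
  have "(\<lambda>(x, y). frac (x + y)) \<in> measurable (S1_borel \<Otimes>\<^sub>M S1_borel) S1_borel"
    by (simp add: case_prod_beta')
  ultimately show ?thesis by (simp cong: measurable_cong_sets)
qed

text \<open>Doubling is an endomorphism of the circle group, so addition intertwines it with the
  product map, which preserves the product measure.\<close>

lemma conv_doubling_invariant:
  assumes "doubling_invariant M" "doubling_invariant N"
  shows "doubling_invariant (conv_S1 M N)"
proof -
  interpret M: doubling_invariant M by fact
  interpret N: doubling_invariant N by fact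
  interpret P: pair_prob_space M N ..
  let ?add = "\<lambda>(x, y). frac (x + y)" and ?P = "M \<Otimes>\<^sub>M N" and ?T = "\<lambda>(x, y). (doubling x, doubling y)"
  note add = measurable_add_S1[OF M.sets_M N.sets_M]
  have T: "?T \<in> measurable ?P ?P"
    using M.measurable_doubling_M N.measurable_doubling_M by measurable
  have PT: "distr ?P ?P ?T = ?P"
    using pair_measure_distr[OF M.measurable_doubling_M N.measurable_doubling_M]
    by (simp add: M.distr_doubling N.distr_doubling N.sigma_finite_measure_axioms)
  interpret real_prob_space "conv_S1 M N"
    unfolding conv_S1_def by (intro real_prob_space.intro P.prob_space_distr add)
  show ?thesis
  proof
    show s: "sets (conv_S1 M N) = sets S1_borel" by (simp add: conv_S1_def)
    have "distr (conv_S1 M N) (conv_S1 M N) doubling = distr (conv_S1 M N) S1_borel doubling"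
      by (rule distr_cong) (auto simp: s)
    also have "\<dots> = distr ?P S1_borel (doubling \<circ> ?add)"
      unfolding conv_S1_def by (rule distr_distr[OF measurable_doubling add])
    also have "doubling \<circ> ?add = ?add \<circ> ?T"
      by (auto simp: fun_eq_iff doubling_frac_add)
    also have "distr ?P S1_borel (?add \<circ> ?T) = distr (distr ?P ?P ?T) S1_borel ?add"
      by (rule distr_distr[symmetric, OF add T])
    also have "\<dots> = conv_S1 M N" by (simp add: PT conv_S1_def)
    finally show "distr (conv_S1 M N) (conv_S1 M N) doubling = conv_S1 M N" .
  qed
qed

lemma distr_pair_snd:
  assumes "prob_space M" "prob_space N"
  shows "distr (M \<Otimes>\<^sub>M N) N snd = N"
proof (rule measure_eqI)
  interpret M: prob_space M by fact
  interpret N: prob_space N by fact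
  fix A assume "A \<in> sets (distr (M \<Otimes>\<^sub>M N) N snd)"
  then have A: "A \<in> sets N" by simp
  have "emeasure (distr (M \<Otimes>\<^sub>M N) N snd) A = emeasure (M \<Otimes>\<^sub>M N) (space M \<times> A)"
    using A sets.sets_into_space[OF A]
    by (auto simp: emeasure_distr space_pair_measure intro!: arg_cong2[where f=emeasure])
  then show "emeasure (distr (M \<Otimes>\<^sub>M N) N snd) A = emeasure N A"
    using A by (simp add: N.emeasure_pair_measure_Times M.emeasure_space_1)
qed simp

text \<open>For fixed x, the translate of a fibre of the doubling map by x is again a fibre, so
  y \<mapsto> J (x + y) is normalised and the ratio J (x + y) / K (y) has mean 1.\<close>

lemma jacobian_conv:
  assumes M: "prob_space M" "sets M = sets S1_borel"
    and N: "jacobian N K" and NU: "jacobian (conv_S1 M N) J"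
    and c: "0 < c" "\<And>x. x \<in> S1 \<Longrightarrow> c \<le> K x"
  shows "(\<integral>x. - ln (K x) \<partial>N) \<le> (\<integral>x. - ln (J x) \<partial>conv_S1 M N)"
    and "(\<integral>x. - ln (K x) \<partial>N) = (\<integral>x. - ln (J x) \<partial>conv_S1 M N) \<Longrightarrow>
      AE x in M. AE y in N. J (frac (x + y)) = K y"
proof -
  interpret M: prob_space M by fact
  interpret N: jacobian N K by fact
  interpret NU: jacobian "conv_S1 M N" J by fact
  interpret P: pair_prob_space M N ..
  note [measurable_cong] = M(2) N.sets_M
  have spM: "space M = S1" using sets_eq_imp_space_eq[OF M(2)] by simp
  let ?P = "M \<Otimes>\<^sub>M N" and ?add = "\<lambda>(x, y). frac (x + y)"
  have spP: "space ?P = S1 \<times> S1" by (simp add: space_pair_measure spM)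
  note add = measurable_add_S1[OF M(2) N.sets_M]
  define R where "R = (\<lambda>(x, y). J (frac (x + y)) / K y)"
  have Jadd[measurable]: "(\<lambda>(x, y). J (frac (x + y))) \<in> borel_measurable ?P"
    using measurable_compose[OF add NU.J_meas] by (simp add: case_prod_beta')
  have R[measurable]: "R \<in> borel_measurable ?P"
    unfolding R_def case_prod_beta' using Jadd[unfolded case_prod_beta'] by measurable
  have R0: "0 \<le> R p" if "p \<in> space ?P" for p
    using that by (auto simp: R_def spP intro!: divide_nonneg_nonneg NU.J_nonneg N.J_nonneg)
  have fibre: "J (frac (x + z / 2)) + J (frac (x + (z + 1) / 2)) = 1" for x z
  proof -
    \<comment> \<open>The other point of the fibre is reached by a rotation by 1/2, also after
      translation by x.\<close>
    have "frac (x + (z + 1) / 2) = frac (frac (x + z / 2) + 1 / 2)"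
      by (simp add: add_divide_distrib add.assoc)
    then show ?thesis using NU.J_add_half[of "frac (x + z / 2)"] by simp
  qed
  have "(\<integral>\<^sup>+ p. ennreal (R p) \<partial>?P) = (\<integral>\<^sup>+ x. \<integral>\<^sup>+ y. ennreal (R (x, y)) \<partial>N \<partial>M)"
    by (rule N.nn_integral_fst[symmetric]) measurable
  also have "\<dots> = (\<integral>\<^sup>+ x. 1 \<partial>M)"
  proof (rule nn_integral_cong)
    fix x assume x: "x \<in> space M"
    have [measurable]: "(\<lambda>y. R (x, y)) \<in> borel_measurable S1_borel"
      using measurable_compose[OF measurable_Pair1'[OF x] R] by (simp add: N.measurable_M_eq)
    have "(\<integral>\<^sup>+ y. ennreal (R (x, y)) \<partial>N) =
      (\<integral>\<^sup>+ z. ennreal (K (z / 2)) * ennreal (R (x, z / 2)) + ennreal (K ((z + 1) / 2)) * ennreal (R (x, (z + 1) / 2)) \<partial>N)"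
      by (rule N.J_int) measurable
    also have "\<dots> = (\<integral>\<^sup>+ z. 1 \<partial>N)"
    proof (rule nn_integral_cong)
      fix z assume "z \<in> space N"
      then have z: "z \<in> S1" by simp
      have *: "ennreal (K w) * ennreal (R (x, w)) = ennreal (J (frac (x + w)))" if "w \<in> S1" for w
        using c(1) c(2)[OF that] NU.J_nonneg[of "frac (x + w)"] by (simp add: R_def ennreal_mult'[symmetric])
      show "ennreal (K (z / 2)) * ennreal (R (x, z / 2)) + ennreal (K ((z + 1) / 2)) * ennreal (R (x, (z + 1) / 2)) = 1"
        using z fibre[of x z] by (simp add: * ennreal_plus[symmetric] NU.J_nonneg del: ennreal_plus)
    qed
    also have "\<dots> = 1" using N.emeasure_space_1 by simp
    finally show "(\<integral>\<^sup>+ y. ennreal (R (x, y)) \<partial>N) = 1" .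
  qed
  also have "\<dots> = 1" using M.emeasure_space_1 by simp
  finally have R1: "(\<integral>\<^sup>+ p. ennreal (R p) \<partial>?P) = 1" .
  have nn: "AE p in ?P. 0 \<le> R p" using AE_space by eventually_elim (rule R0)
  have iR: "integrable ?P R" using R1 nn by (intro integrableI_nonneg) auto
  have intR: "(\<integral>p. R p \<partial>?P) = 1" using R1 nn_integral_eq_integral[OF iR nn] by simp
  have distr: "conv_S1 M N = distr ?P S1_borel ?add" by (simp add: conv_S1_def)
  have iJ: "integrable ?P (\<lambda>p. ln (J (?add p)))"
    using NU.integrable_ln_J unfolding distr by (subst (asm) integrable_distr_eq[OF add]) auto
  have intJ: "(\<integral>p. ln (J (?add p)) \<partial>?P) = (\<integral>x. ln (J x) \<partial>conv_S1 M N)"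
    unfolding distr by (rule integral_distr[OF add, symmetric]) measurable
  have Nsnd: "distr ?P N snd = N" by (rule distr_pair_snd) unfold_locales
  have lnK: "(\<lambda>x. ln (K x)) \<in> borel_measurable N" by measurable
  have iK: "integrable ?P (\<lambda>p. ln (K (snd p)))"
    using N.integrable_ln_J integrable_distr_eq[OF measurable_snd[of M N] lnK] by (simp add: Nsnd)
  have intK: "(\<integral>p. ln (K (snd p)) \<partial>?P) = (\<integral>x. ln (K x) \<partial>N)"
    using integral_distr[OF measurable_snd[of M N] lnK] by (simp add: Nsnd)
  \<comment> \<open>\<open>?D\<close> is R - 1 - ln R almost everywhere, hence nonnegative; since R
    has mean 1, its integral is the gap between the two sides of the claim.\<close>
  let ?D = "\<lambda>p. R p - 1 - (ln (J (?add p)) - ln (K (snd p)))"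
  have "AE z in distr ?P S1_borel ?add. 0 < J z"
    unfolding distr[symmetric] by (rule NU.AE_J_pos)
  from AE_distrD[OF add this] AE_space
  have Rpos: "AE p in ?P. 0 < R p \<and> ln (R p) = ln (J (?add p)) - ln (K (snd p))"
  proof eventually_elim
    case (elim p)
    then have "0 < J (?add p)" "0 < K (snd p)" using c(1) c(2)[of "snd p"] by (auto simp: spP)
    then show ?case by (auto simp: R_def ln_div split: prod.splits)
  qed
  have D0: "AE p in ?P. 0 \<le> ?D p"
    using Rpos
  proof eventually_elim
    case (elim p)
    then show ?case using ln_le_minus_one[of "R p"] by simp
  qed
  have iD: "integrable ?P ?D" using iR iJ iK by simp
  have intD: "(\<integral>p. ?D p \<partial>?P) = (\<integral>x. - ln (J x) \<partial>conv_S1 M N) - (\<integral>x. - ln (K x) \<partial>N)"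
    using iR iJ iK by (simp add: intR intJ intK P.prob_space)
  have "0 \<le> (\<integral>p. ?D p \<partial>?P)" using D0 by (rule integral_nonneg_AE)
  then show "(\<integral>x. - ln (K x) \<partial>N) \<le> (\<integral>x. - ln (J x) \<partial>conv_S1 M N)" unfolding intD by simp
  assume "(\<integral>x. - ln (K x) \<partial>N) = (\<integral>x. - ln (J x) \<partial>conv_S1 M N)"
  then have "(\<integral>p. ?D p \<partial>?P) = 0" unfolding intD by simp
  then have "AE p in ?P. ?D p = 0" using integral_nonneg_eq_0_iff_AE[OF iD D0] by simp
  with Rpos AE_space have "AE p in ?P. J (frac (fst p + snd p)) = K (snd p)"
  proof eventually_elim
    case (elim p)
    \<comment> \<open>Equality in ln t <= t - 1 occurs only at t = 1.\<close>
    then have "R p = 1" by (intro ln_eq_minus_one) auto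
    moreover have "0 < K (snd p)" using elim c(1) c(2)[of "snd p"] by (auto simp: spP)
    ultimately show ?case by (auto simp: R_def split: prod.splits)
  qed
  from P.AE_pair[OF this] show "AE x in M. AE y in N. J (frac (x + y)) = K y" by simp
qed

section \<open>Rigidity in the case of equality\<close>

lemma (in prob_space) AE_imp_ex:
  assumes "AE x in M. P x"
  shows "\<exists>x\<in>space M. P x"
proof (rule ccontr)
  assume none: "\<not> (\<exists>x\<in>space M. P x)"
  from assms AE_space have "AE x in M. False" by eventually_elim (use none in blast)
  then show False using emeasure_space_1 by (simp add: AE_False)
qed

text \<open>Both measures are quasi-invariant under dyadic rotations, so in a generic pair x and y can be
  moved by opposite dyadic amounts, which leaves x + y unchanged.\<close>

lemma constant_of_translate:
  assumes M: "jacobian M J1" "\<And>x. x \<in> S1 \<Longrightarrow> 0 < J1 x"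
    and N: "jacobian N J2" "\<And>x. x \<in> S1 \<Longrightarrow> 0 < J2 x"
    and osc: "\<And>e. 0 < e \<Longrightarrow> \<exists>r>0. \<forall>x\<in>S1. \<forall>y\<in>S1. \<bar>x - y\<bar> < r \<longrightarrow> \<bar>J2 x - J2 y\<bar> \<le> e"
    and AE: "AE x in M. AE y in N. J (frac (x + y)) = J2 y"
  shows "\<exists>b. \<forall>t\<in>S1. J2 t = b"
proof -
  interpret M: jacobian M J1 by fact
  interpret N: jacobian N J2 by fact
  let ?G = "\<lambda>x y. J (frac (x + y)) = J2 y"
  \<comment> \<open>One x is fixed all of whose dyadic rotations are good. There are countably many
    of them, so one y can then be found that is good, with all its rotations, for all of them at
    once.\<close>
  have "\<exists>x\<in>space M. \<forall>n. \<forall>x'\<in>S1. (doubling ^^ n) x' = (doubling ^^ n) x \<longrightarrow> (AE y in N. ?G x' y)"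
    by (intro M.AE_imp_ex M.AE_grand_orbit[OF M(2)] AE)
  then obtain x where x: "x \<in> S1"
    and Gx: "\<And>n x'. x' \<in> S1 \<Longrightarrow> (doubling ^^ n) x' = (doubling ^^ n) x \<Longrightarrow> AE y in N. ?G x' y"
    by auto
  have "AE y in N. \<forall>n k. ?G (frac (x - of_int k / 2 ^ n)) y"
    unfolding AE_all_countable
  proof (intro allI)
    fix n :: nat and k :: int
    show "AE y in N. ?G (frac (x - of_int k / 2 ^ n)) y"
      using dyadic_shift[OF x, of n "- k"] by (intro Gx[of _ n]) auto
  qed
  then have "\<exists>y\<in>space N. \<forall>m. \<forall>y'\<in>S1. (doubling ^^ m) y' = (doubling ^^ m) y \<longrightarrow> (\<forall>n k. ?G (frac (x - of_int k / 2 ^ n)) y')"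
    by (intro N.AE_imp_ex N.AE_grand_orbit[OF N(2)])
  then obtain y where y: "y \<in> S1"
    and Gy: "\<And>m y' n k. y' \<in> S1 \<Longrightarrow> (doubling ^^ m) y' = (doubling ^^ m) y \<Longrightarrow> ?G (frac (x - of_int k / 2 ^ n)) y'"
    by auto
  have dy: "J2 (frac (y + of_int k / 2 ^ n)) = J (frac (x + y))" for n k
  proof -
    have "?G (frac (x - of_int k / 2 ^ n)) (frac (y + of_int k / 2 ^ n))"
      by (rule Gy[of _ n]) (simp_all add: dyadic_shift[OF y])
    moreover have "frac (frac (x - of_int k / 2 ^ n) + frac (y + of_int k / 2 ^ n)) =
        frac ((x - of_int k / 2 ^ n) + (y + of_int k / 2 ^ n))"
      by (simp only: frac_add_simps)
    ultimately show ?thesis by simp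
  qed
  \<comment> \<open>The value is known on the dyadic rotations of y, which are dense; continuity of
    J2 extends it. A deviation at t would be at most half of itself.\<close>
  have "J2 t = J (frac (x + y))" if t: "t \<in> S1" for t
  proof (rule ccontr)
    let ?e = "\<bar>J2 t - J (frac (x + y))\<bar> / 2"
    assume "J2 t \<noteq> J (frac (x + y))"
    then have e: "0 < ?e" by simp
    obtain r where r: "r > 0" "\<And>x y. x \<in> S1 \<Longrightarrow> y \<in> S1 \<Longrightarrow> \<bar>x - y\<bar> < r \<Longrightarrow> \<bar>J2 x - J2 y\<bar> \<le> ?e"
      using osc[OF e] by blast
    obtain n k where "\<bar>frac (y + of_int k / 2 ^ n) - t\<bar> < r" using dyadic_shift_dense[OF y t r(1)] .
    from r(2)[OF _ t this] have "\<bar>J (frac (x + y)) - J2 t\<bar> \<le> ?e" by (simp add: dy)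
    then show False using e by (simp add: abs_minus_commute)
  qed
  then show ?thesis by blast
qed

theorem theorem3:
  fixes J1 J2 :: "real \<Rightarrow> real" and \<mu>1 \<mu>2 :: "real measure"
  assumes pos1: "\<forall>x\<in>S1. J1 x > 0" and pos2: "\<forall>x\<in>S1. J2 x > 0"
    and hol1: "holder_S1 J1" and hol2: "holder_S1 J2"
    and norm1: "\<forall>y\<in>S1. (\<Sum>x\<in>{x\<in>S1. doubling x = y}. J1 x) = 1"
    and norm2: "\<forall>y\<in>S1. (\<Sum>x\<in>{x\<in>S1. doubling x = y}. J2 x) = 1"
    and g1: "gibbs_S1 J1 \<mu>1" and g2: "gibbs_S1 J2 \<mu>2"
  shows "ks_entropy (conv_S1 \<mu>1 \<mu>2) \<ge> ks_entropy \<mu>2 \<and>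
    (\<mu>1 \<noteq> lebesgue_S1 \<and> \<mu>2 \<noteq> lebesgue_S1 \<longrightarrow> ks_entropy (conv_S1 \<mu>1 \<mu>2) > ks_entropy \<mu>2)"
proof -
  interpret P1: real_prob_space \<mu>1 using g1 by (intro real_prob_space.intro) (simp add: gibbs_S1_def prob_S1_def)
  interpret P2: real_prob_space \<mu>2 using g2 by (intro real_prob_space.intro) (simp add: gibbs_S1_def prob_S1_def)
  interpret A: jacobian \<mu>1 J1
    by (rule P1.jacobian_of_gibbs[OF g1]) (use pos1 norm1 holder_S1_measurable[OF hol1] in \<open>auto intro: less_imp_le\<close>)
  interpret B: jacobian \<mu>2 J2
    by (rule P2.jacobian_of_gibbs[OF g2]) (use pos2 norm2 holder_S1_measurable[OF hol2] in \<open>auto intro: less_imp_le\<close>)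
  interpret N: doubling_invariant "conv_S1 \<mu>1 \<mu>2"
    by (rule conv_doubling_invariant) unfold_locales
  obtain J where J: "jacobian (conv_S1 \<mu>1 \<mu>2) J" using N.jacobian_exists by blast
  interpret J: jacobian "conv_S1 \<mu>1 \<mu>2" J by (rule J)
  have p1: "0 < J1 x" and p2: "0 < J2 x" if "x \<in> S1" for x using pos1 pos2 that by auto
  obtain c where c: "0 < c" "\<And>x. x \<in> S1 \<Longrightarrow> c \<le> J2 x"
    using holder_S1_lower_bound[OF hol2 p2] by blast
  note conv = jacobian_conv[OF P1.prob_space_axioms A.sets_M B.jacobian_axioms J c(1)]
  have conv1: "(\<integral>x. - ln (J2 x) \<partial>\<mu>2) \<le> (\<integral>x. - ln (J x) \<partial>conv_S1 \<mu>1 \<mu>2)"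
    by (rule conv(1)) (fact c(2))
  have up: "ks_entropy \<mu>2 \<le> (\<integral>x. - ln (J2 x) \<partial>\<mu>2)"
    by (rule B.ks_entropy_le_integral[OF c holder_S1_uniform[OF hol2]])
  have ge: "ks_entropy \<mu>2 \<le> ks_entropy (conv_S1 \<mu>1 \<mu>2)"
    using up conv1 J.integral_le_ks_entropy by linarith
  have "\<mu>2 = lebesgue_S1" if "\<not> ks_entropy \<mu>2 < ks_entropy (conv_S1 \<mu>1 \<mu>2)"
  proof -
    \<comment> \<open>If the entropies do not differ strictly, all terms of the chain between them
      coincide.\<close>
    have "(\<integral>x. - ln (J2 x) \<partial>\<mu>2) = (\<integral>x. - ln (J x) \<partial>conv_S1 \<mu>1 \<mu>2)"
      using that up conv1 J.integral_le_ks_entropy by linarith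
    then have ae: "AE x in \<mu>1. AE y in \<mu>2. J (frac (x + y)) = J2 y"
      by (intro conv(2) c(2))
    have "\<exists>b. \<forall>t\<in>S1. J2 t = b"
      by (rule constant_of_translate[OF A.jacobian_axioms p1 B.jacobian_axioms p2 holder_S1_uniform[OF hol2] ae])
    then obtain b where b: "\<And>t. t \<in> S1 \<Longrightarrow> J2 t = b" by blast
    \<comment> \<open>The fibre of 0 consists of 0 and 1/2, so normalisation reads b + b =
      1.\<close>
    have "J2 t = 1 / 2" if "t \<in> S1" for t
      using B.J_sum[of 0] b[of 0] b[of "1/2"] b[OF that] by (simp add: S1_def)
    then show ?thesis by (rule jacobian_half_unique[OF B.jacobian_axioms jacobian_lebesgue]) simp_all
  qed
  then show ?thesis using ge by blast
qed

end
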